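(* Let $T$ be a rooted tree as in the context, let $p\in(1,\infty)$ with Hölder conjugate $p'$, let $E\subseteq\partial T$ be a Borel set with $c_p(E)>0$, and let $\zeta\in E$. Then $\zeta$ is irregular for $E$ (that is, $If^E(\zeta)\neq 1$, where $f^E$ is the $p$-equilibrium function of $E$) if and only if $$\sum_{\alpha<\zeta} c_{\alpha,p}(E_\alpha)^{p'/p}<\infty,$$ where $E_\alpha:=E\cap\partial T_\alpha$ and $c_{\alpha,p}$ denotes the $p$-capacity relative to the subtree $T_\alpha$ rooted at the edge $\alpha$.
   Context: Tree: $T$ is a locally finite tree (connected graph without cycles, every vertex having finitely many neighbours) with vertex set $V(T)$, edge set $E(T)$ and a distinguished root edge $\omega$. One endpoint $o=b(\omega)$ of $\omega$ is an endpoint of no other edge, and every vertex other than $o$ is an endpoint of at least two edges (no leaves). For an edge $\alpha$, $b(\alpha)$ is its endpoint nearer to $o$ and $e(\alpha)$ the other endpoint. For edges, $\beta\le\alpha$ means that $\beta$ lies on the shortest edge path from $\omega$ to $\alpha$ (both included). The boundary $\partial T$ is the set of infinite geodesics (infinite edge paths without backtracking) starting with $\omega$; $\partial T_\alpha$ is the set of those passing through $\alpha$, and the sets $\partial T_\alpha$, $\alpha\in E(T)$, form a basis of the topology of $\partial T$. For $\zeta\in\partial T$, $\alpha<\zeta$ means that the edge $\alpha$ belongs to the geodesic $\zeta$. Potential: for $f:E(T)\to[0,\infty)$ and $\zeta\in\partial T$, $If(\zeta)=\sum_{\alpha<\zeta}f(\alpha)\in[0,+\infty]$. Capacity: for a Borel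 set $E\subseteq\partial T$, $c_p(E)=\inf\{\sum_{\alpha\in E(T)}f(\alpha)^p:\ f:E(T)\to[0,\infty),\ If\ge 1\text{ on }E\}$. A property holds $c_p$-a.e. if the exceptional set has $p$-capacity zero. For a Borel set $E$ there is a unique function $f^E:E(T)\to[0,\infty)$ with $If^E=1$ $c_p$-a.e. on $E$ and $\sum_\alpha f^E(\alpha)^p=c_p(E)$; it is called the $p$-equilibrium function of $E$ (its existence and uniqueness is a known fact). A point $\zeta\in E$ is irregular for $E$ if $If^E(\zeta)\ne1$. Subtrees: $T_\alpha$ is the tree with edge set $\{\beta:\beta\ge\alpha\}$, root edge $\alpha$, and boundary identified with $\partial T_\alpha$. Thus for Borel $F\subseteq\partial T_\alpha$, $c_{\alpha,p}(F)=\inf\{\sum_{\beta\ge\alpha}f(\beta)^p:\ f\ge0,\ \sum_{\alpha\le\beta<\zeta}f(\beta)\ge1\ \text{for all }\zeta\in F\}$. *)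

theory Defs
  imports "HOL-Analysis.Analysis"
begin

text \<open>Edges are unordered pairs of vertices, represented as two-element sets.\<close>

record 'v rtree =
  verts :: "'v set"
  edges :: "'v set set"
  root_edge :: "'v set"
  root_vertex :: 'v

definition walk :: "'v rtree \<Rightarrow> 'v list \<Rightarrow> bool" where
  "walk T xs \<longleftrightarrow>
     xs \<noteq> [] \<and> set xs \<subseteq> verts T \<and> successively (\<lambda>x y. {x, y} \<in> edges T) xs"

definition simple_graph :: "'v rtree \<Rightarrow> bool" where
  "simple_graph T \<longleftrightarrow>
     (\<forall>e\<in>edges T. \<exists>x\<in>verts T. \<exists>y\<in>verts T. x \<noteq> y \<and> e = {x, y})"

definition connected_graph :: "'v rtree \<Rightarrow> bool" where
  "connected_graph T \<longleftrightarrow>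
     (\<forall>x\<in>verts T. \<forall>y\<in>verts T. \<exists>xs. walk T xs \<and> hd xs = x \<and> last xs = y)"

text \<open>A cycle is a closed walk with at least three edges and no repeated vertex except that
  its first and last vertices coincide.\<close>

definition is_cycle :: "'v rtree \<Rightarrow> 'v list \<Rightarrow> bool" where
  "is_cycle T xs \<longleftrightarrow> walk T xs \<and> 4 \<le> length xs \<and> hd xs = last xs \<and> distinct (tl xs)"

definition is_tree :: "'v rtree \<Rightarrow> bool" where
  "is_tree T \<longleftrightarrow> simple_graph T \<and> connected_graph T \<and> (\<nexists>xs. is_cycle T xs)"

definition locally_finite :: "'v rtree \<Rightarrow> bool" where
  "locally_finite T \<longleftrightarrow> (\<forall>x\<in>verts T. finite {y. {x, y} \<in> edges T})"

definition rooted_tree :: "'v rtree \<Rightarrow> bool" where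
  "rooted_tree T \<longleftrightarrow>
     is_tree T \<and> locally_finite T \<and>
     root_edge T \<in> edges T \<and> root_vertex T \<in> root_edge T \<and>
     (\<forall>e\<in>edges T. root_vertex T \<in> e \<longrightarrow> e = root_edge T) \<and>
     (\<forall>x\<in>verts T. x \<noteq> root_vertex T \<longrightarrow> 2 \<le> card {e \<in> edges T. x \<in> e})"

definition walk_edges :: "'v list \<Rightarrow> 'v set list" where
  "walk_edges xs = map (\<lambda>(x, y). {x, y}) (zip xs (tl xs))"

definition edge_path :: "'v rtree \<Rightarrow> 'v set \<Rightarrow> 'v set list \<Rightarrow> 'v set \<Rightarrow> bool" where
  "edge_path T \<alpha> es \<beta> \<longleftrightarrow>
     (\<exists>xs. walk T xs \<and> es = walk_edges xs) \<and> es \<noteq> [] \<and> hd es = \<alpha> \<and> last es = \<beta>"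

definition shortest_edge_path :: "'v rtree \<Rightarrow> 'v set \<Rightarrow> 'v set list \<Rightarrow> 'v set \<Rightarrow> bool" where
  "shortest_edge_path T \<alpha> es \<beta> \<longleftrightarrow>
     edge_path T \<alpha> es \<beta> \<and> (\<forall>es'. edge_path T \<alpha> es' \<beta> \<longrightarrow> length es \<le> length es')"

definition edge_le :: "'v rtree \<Rightarrow> 'v set \<Rightarrow> 'v set \<Rightarrow> bool" where
  "edge_le T \<beta> \<alpha> \<longleftrightarrow> (\<exists>es. shortest_edge_path T (root_edge T) es \<alpha> \<and> \<beta> \<in> set es)"

text \<open>A boundary point is the sequence of edges \<open>\<zeta> 0, \<zeta> 1, \<dots>\<close> traversed by a non-backtracking
  infinite walk; the edges belonging to it form the set \<open>range \<zeta>\<close>.\<close>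

definition boundary :: "'v rtree \<Rightarrow> (nat \<Rightarrow> 'v set) set" where
  "boundary T =
     {\<zeta>. \<zeta> 0 = root_edge T \<and>
         (\<exists>x. \<forall>n. x n \<in> verts T \<and> \<zeta> n = {x n, x (Suc n)} \<and> \<zeta> n \<in> edges T \<and>
                  x (Suc (Suc n)) \<noteq> x n)}"

definition boundary_through :: "'v rtree \<Rightarrow> 'v set \<Rightarrow> (nat \<Rightarrow> 'v set) set" where
  "boundary_through T \<alpha> = {\<zeta> \<in> boundary T. \<alpha> \<in> range \<zeta>}"

definition boundary_topology :: "'v rtree \<Rightarrow> (nat \<Rightarrow> 'v set) topology" where
  "boundary_topology T = topology_generated_by (boundary_through T ` edges T)"

definition boundary_borel :: "'v rtree \<Rightarrow> (nat \<Rightarrow> 'v set) set set" where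
  "boundary_borel T = sigma_sets (boundary T) {U. openin (boundary_topology T) U}"

definition potential :: "('v set \<Rightarrow> real) \<Rightarrow> (nat \<Rightarrow> 'v set) \<Rightarrow> ennreal" where
  "potential f \<zeta> = (\<Sum>\<^sub>\<infinity>\<alpha>\<in>range \<zeta>. ennreal (f \<alpha>))"

definition capacity :: "'v rtree \<Rightarrow> real \<Rightarrow> (nat \<Rightarrow> 'v set) set \<Rightarrow> ennreal" where
  "capacity T p E =
     Inf {\<Sum>\<^sub>\<infinity>\<alpha>\<in>edges T. ennreal (f \<alpha> powr p) | f.
            (\<forall>\<alpha>\<in>edges T. 0 \<le> f \<alpha>) \<and> (\<forall>\<zeta>\<in>E. 1 \<le> potential f \<zeta>)}"

definition equilibrium_function ::
    "'v rtree \<Rightarrow> real \<Rightarrow> (nat \<Rightarrow> 'v set) set \<Rightarrow> ('v set \<Rightarrow> real) \<Rightarrow> bool" where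
  "equilibrium_function T p E f \<longleftrightarrow>
     (\<forall>\<alpha>\<in>edges T. 0 \<le> f \<alpha>) \<and>
     capacity T p {\<zeta> \<in> E. potential f \<zeta> \<noteq> 1} = 0 \<and>
     (\<Sum>\<^sub>\<infinity>\<alpha>\<in>edges T. ennreal (f \<alpha> powr p)) = capacity T p E"

definition subtree_edges :: "'v rtree \<Rightarrow> 'v set \<Rightarrow> 'v set set" where
  "subtree_edges T \<alpha> = {\<beta> \<in> edges T. edge_le T \<alpha> \<beta>}"

definition subtree_capacity ::
    "'v rtree \<Rightarrow> 'v set \<Rightarrow> real \<Rightarrow> (nat \<Rightarrow> 'v set) set \<Rightarrow> ennreal" where
  "subtree_capacity T \<alpha> p F =
     Inf {\<Sum>\<^sub>\<infinity>\<beta>\<in>subtree_edges T \<alpha>. ennreal (f \<beta> powr p) | f.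
            (\<forall>\<beta>\<in>subtree_edges T \<alpha>. 0 \<le> f \<beta>) \<and>
            (\<forall>\<zeta>\<in>F. 1 \<le> (\<Sum>\<^sub>\<infinity>\<beta>\<in>range \<zeta> \<inter> subtree_edges T \<alpha>. ennreal (f \<beta>)))}"

lemma topspace_boundary_topology:
  assumes "root_edge T \<in> edges T"
  shows "topspace (boundary_topology T) = boundary T"
proof -
  have "\<zeta> \<in> boundary_through T (root_edge T)" if "\<zeta> \<in> boundary T" for \<zeta>
  proof -
    have "\<zeta> 0 = root_edge T" using that by (simp add: boundary_def)
    then have "root_edge T \<in> range \<zeta>" by (metis rangeI)
    then show ?thesis using that by (simp add: boundary_through_def)
  qed
  moreover have "boundary_through T \<alpha> \<subseteq> boundary T" for \<alpha>
    by (auto simp: boundary_through_def)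
  ultimately show ?thesis
    using assms unfolding boundary_topology_def topology_generated_by_topspace by blast
qed

lemma edge_path_to_ray_edge:
  assumes "\<zeta> \<in> boundary T"
  shows "\<exists>es. edge_path T (root_edge T) es (\<zeta> n)"
proof -
  obtain x where x: "\<And>k. x k \<in> verts T" "\<And>k. \<zeta> k = {x k, x (Suc k)}" "\<And>k. \<zeta> k \<in> edges T"
    and 0: "\<zeta> 0 = root_edge T"
    using assms unfolding boundary_def mem_Collect_eq by metis
  define xs where "xs = map x [0..<n + 2]"
  have len: "length xs = n + 2" by (simp add: xs_def)
  have xs_nth: "xs ! i = x i" if "i < n + 2" for i
    using that by (simp add: xs_def del: upt_Suc)
  have tl_nth: "tl xs ! i = x (Suc i)" if "i < n + 1" for i
    using that len by (simp add: nth_tl xs_nth)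
  have "walk T xs"
    unfolding walk_def successively_conv_nth
  proof (intro conjI allI impI)
    show "xs \<noteq> []" using len by auto
    show "set xs \<subseteq> verts T" using x(1) by (auto simp: xs_def)
    fix i assume "Suc i < length xs"
    then show "{xs ! i, xs ! Suc i} \<in> edges T"
      using len xs_nth[of i] xs_nth[of "Suc i"] x(2,3)[of i] by simp
  qed
  moreover have "walk_edges xs = map \<zeta> [0..<n + 1]"
    by (rule nth_equalityI)
      (auto simp: walk_edges_def len xs_nth tl_nth x(2) simp del: upt_Suc)
  then have "walk_edges xs \<noteq> []" "hd (walk_edges xs) = \<zeta> 0" "last (walk_edges xs) = \<zeta> n"
    by (simp_all add: hd_map last_map del: upt_Suc)
  ultimately show ?thesis unfolding edge_path_def 0[symmetric] by blast
qed

lemma edge_le_refl_ray: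
  assumes "\<zeta> \<in> boundary T"
  shows "edge_le T (\<zeta> n) (\<zeta> n)"
proof -
  obtain es where "edge_path T (root_edge T) es (\<zeta> n)"
      "\<And>es'. edge_path T (root_edge T) es' (\<zeta> n) \<Longrightarrow> length es \<le> length es'"
    using edge_path_to_ray_edge[OF assms]
      ex_has_least_nat[of "\<lambda>es. edge_path T (root_edge T) es (\<zeta> n)" _ length] by blast
  then show ?thesis
    unfolding edge_le_def shortest_edge_path_def by (metis edge_path_def last_in_set)
qed

text \<open>The capacities in question are finite, so passing to real numbers by \<^const>\<open>enn2real\<close>
  loses nothing.\<close>

lemma subtree_capacity_le_1:
  assumes F: "F \<subseteq> boundary_through T \<alpha>"
  shows "subtree_capacity T \<alpha> p F \<le> 1"
proof -
  define f where "f = (\<lambda>\<beta>. if \<beta> = \<alpha> then 1 else 0 :: real)"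
  have "1 \<le> (\<Sum>\<^sub>\<infinity>\<beta>\<in>range \<zeta> \<inter> subtree_edges T \<alpha>. ennreal (f \<beta>))" if \<zeta>F: "\<zeta> \<in> F" for \<zeta>
  proof -
    obtain n where n: "\<alpha> = \<zeta> n" and \<zeta>: "\<zeta> \<in> boundary T"
      using subsetD[OF F \<zeta>F] unfolding boundary_through_def by auto
    have "\<zeta> n \<in> edges T" using \<zeta> unfolding boundary_def by auto
    then have "\<alpha> \<in> range \<zeta> \<inter> subtree_edges T \<alpha>"
      using n edge_le_refl_ray[OF \<zeta>, of n] by (auto simp: subtree_edges_def)
    then have "(\<Sum>\<^sub>\<infinity>\<beta>\<in>range \<zeta> \<inter> subtree_edges T \<alpha>. ennreal (f \<beta>)) = (\<Sum>\<^sub>\<infinity>\<beta>\<in>{\<alpha>}. ennreal (f \<beta>))"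
      by (intro infsum_cong_neutral) (auto simp: f_def)
    then show ?thesis by (simp add: f_def)
  qed
  then have "subtree_capacity T \<alpha> p F \<le> (\<Sum>\<^sub>\<infinity>\<beta>\<in>subtree_edges T \<alpha>. ennreal (f \<beta> powr p))"
    unfolding subtree_capacity_def by (intro Inf_lower) (auto simp: f_def)
  also have "\<dots> = (\<Sum>\<^sub>\<infinity>\<beta>\<in>subtree_edges T \<alpha> \<inter> {\<alpha>}. ennreal (f \<beta> powr p))"
    by (intro infsum_cong_neutral) (auto simp: f_def)
  also have "\<dots> \<le> 1"
    by (cases "\<alpha> \<in> subtree_edges T \<alpha>") (auto simp: f_def)
  finally show ?thesis .
qed

end

theory Submission
  imports Defs
begin

text \<open>
  Write \<open>u\<^sub>n = 1 - (f(\<zeta>\<^sub>0) + \<dots> + f(\<zeta>\<^sub>n\<^sub>-\<^sub>1))\<close> and \<open>c\<^sub>n\<close> for the capacity of the part of \<open>E\<close> below \<open>\<zeta>\<^sub>n\<close>, relative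
  to the subtree rooted there. Exchanging the equilibrium function below \<open>\<zeta>\<^sub>n\<close> with rescaled
  competitors for the subtree shows that its energy there is exactly \<open>u\<^sub>n\<^sup>p c\<^sub>n\<close>. Varying only the
  share of \<open>u\<^sub>n\<close> that is spent on the edge \<open>\<zeta>\<^sub>n\<close> itself, the vanishing of the derivative at the
  minimum gives \<open>f(\<zeta>\<^sub>n) = u\<^sub>n d\<^sub>n\<close> with \<open>d\<^sub>n = c\<^sub>n\<close> to the power \<open>1/(p-1) = p'/p\<close>. Hence
  \<open>u\<^sub>n\<^sub>+\<^sub>1 = u\<^sub>n (1 - d\<^sub>n)\<close>, where \<open>d\<^sub>n < 1\<close> by local finiteness, and \<open>\<zeta>\<close> is irregular iff \<open>u\<^sub>n\<close> does
  not tend to \<open>0\<close>, that is, iff \<open>\<Sum> d\<^sub>n\<close> converges.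
\<close>

section \<open>Geodesics in trees\<close>

definition nonbacktracking :: "'v list \<Rightarrow> bool" where
  "nonbacktracking xs \<longleftrightarrow> (\<forall>i. Suc (Suc i) < length xs \<longrightarrow> xs ! i \<noteq> xs ! Suc (Suc i))"

lemma nonbacktracking_ConsD: "nonbacktracking (a # xs) \<Longrightarrow> nonbacktracking xs"
  unfolding nonbacktracking_def by (metis Suc_mono length_Cons nth_Cons_Suc)

lemma distinct_imp_nonbacktracking: "distinct xs \<Longrightarrow> nonbacktracking xs"
  by (simp add: nonbacktracking_def nth_eq_iff_index_eq)

text \<open>Walking \<open>xs\<close> backwards to \<open>a\<close> and then along \<open>ys\<close>
  creates only one new triple of consecutive vertices, the one centred at \<open>a\<close>, and its
  ends are the differing heads of \<open>xs\<close> and \<open>ys\<close>.\<close>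

lemma nonbacktracking_rev_join:
  assumes "nonbacktracking (a # xs)" "nonbacktracking (a # ys)" "xs \<noteq> []" "ys \<noteq> []" "hd xs \<noteq> hd ys"
  shows "nonbacktracking (rev xs @ a # ys)"
  unfolding nonbacktracking_def
proof (intro allI impI)
  fix i
  let ?n = "length xs"
  let ?zs = "rev xs @ a # ys"
  assume i: "Suc (Suc i) < length ?zs"
  \<comment> \<open>The vertex \<open>a\<close> sits at position \<open>?n\<close> and is covered by
    both \<open>left\<close> and \<open>right\<close>, so each triple not centred at
    \<open>a\<close> lies entirely within the scope of one of them.\<close>
  have left: "?zs ! j = (a # xs) ! (?n - j)" if "j \<le> ?n" for j
    using that by (auto simp: nth_append rev_nth nth_Cons' Suc_diff_Suc)
  have right: "?zs ! j = (a # ys) ! (j - ?n)" if "?n \<le> j" for j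
    using that by (auto simp: nth_append)
  consider "Suc (Suc i) \<le> ?n" | "Suc i = ?n" | "?n \<le> i" by linarith
  then show "?zs ! i \<noteq> ?zs ! Suc (Suc i)"
  proof cases
    case 1
    define k where "k = ?n - Suc (Suc i)"
    have k: "?n - i = Suc (Suc k)" "Suc (Suc k) < length (a # xs)" using 1 by (auto simp: k_def)
    have "(a # xs) ! k \<noteq> (a # xs) ! Suc (Suc k)"
      using assms(1) k(2) unfolding nonbacktracking_def by blast
    then show ?thesis using left[of i] left[of "Suc (Suc i)"] 1 k by (metis Suc_leD k_def)
  next
    case 2
    have "?n - i = 1" "Suc (Suc i) - ?n = 1" using 2 by auto
    then have "?zs ! i = hd xs" "?zs ! Suc (Suc i) = hd ys"
      using left[of i] right[of "Suc (Suc i)"] 2 assms(3,4) by (auto simp: hd_conv_nth)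
    then show ?thesis using assms(5) by simp
  next
    case 3
    define k where "k = i - ?n"
    have k: "Suc (Suc i) - ?n = Suc (Suc k)" "Suc (Suc k) < length (a # ys)"
      using 3 i by (auto simp: k_def)
    have "(a # ys) ! k \<noteq> (a # ys) ! Suc (Suc k)"
      using assms(2) k(2) unfolding nonbacktracking_def by blast
    then show ?thesis using right[of i] right[of "Suc (Suc i)"] 3 k by (simp add: k_def)
  qed
qed

lemma walk_ConsD: "walk T (a # xs) \<Longrightarrow> xs \<noteq> [] \<Longrightarrow> walk T xs"
  by (auto simp: walk_def successively_Cons)

lemma edge_endpoints_distinct: "is_tree T \<Longrightarrow> {x, y} \<in> edges T \<Longrightarrow> x \<noteq> y"
  unfolding is_tree_def simple_graph_def by (metis doubleton_eq_iff)

text \<open>If the head \<open>a\<close> recurs, the walk \<open>a # us @ [a]\<close> up to its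
  first listed return closes up, and its tail is distinct by induction. An empty \<open>us\<close>
  would be a loop and a one-element \<open>us\<close> a backtrack, so what remains is a
  cycle.\<close>

lemma nonbacktracking_walk_distinct:
  assumes "is_tree T" "walk T xs" "nonbacktracking xs"
  shows "distinct xs"
  using assms(2,3)
proof (induction xs)
  case Nil
  then show ?case by simp
next
  case (Cons a xs)
  show ?case
  proof (cases "xs = []")
    case False
    have d: "distinct xs"
      using Cons.IH[OF walk_ConsD[OF Cons.prems(1) False] nonbacktracking_ConsD[OF Cons.prems(2)]] .
    have "a \<notin> set xs"
    proof
      assume "a \<in> set xs"
      then obtain us vs where xs: "xs = us @ a # vs" by (meson split_list)
      have w: "walk T (a # us @ [a])"
        using Cons.prems(1)
        by (auto simp: xs walk_def successively_Cons successively_append_iff hd_append)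
      have "us \<noteq> []"
        using w edge_endpoints_distinct[OF assms(1), of a a] by (auto simp: walk_def)
      moreover have "tl us \<noteq> []"
      proof
        assume "tl us = []"
        with \<open>us \<noteq> []\<close> obtain b where "us = [b]" by (metis list.collapse)
        then have "\<not> nonbacktracking (a # xs)"
          unfolding nonbacktracking_def xs by (intro notI) (auto dest: spec[of _ 0])
        then show False using Cons.prems(2) by simp
      qed
      ultimately have "2 \<le> length us" by (cases us; cases "tl us") auto
      then have "is_cycle T (a # us @ [a])"
        using w d by (auto simp: is_cycle_def xs)
      then show False using assms(1) by (auto simp: is_tree_def)
    qed
    then show ?thesis using d by simp
  qed simp
qed

text \<open>Where two such walks first diverge, reversing one remainder and continuing along the
  other gives a non-backtracking walk that visits the common last vertex twice, against
  distinctness.\<close>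

lemma nonbacktracking_walk_unique:
  assumes "is_tree T" "walk T xs" "nonbacktracking xs" "walk T ys" "nonbacktracking ys"
    "hd xs = hd ys" "last xs = last ys"
  shows "xs = ys"
  using assms(2-)
proof (induction xs arbitrary: ys)
  case Nil
  then show ?case by (simp add: walk_def)
next
  case (Cons a xs)
  obtain ys' where ys: "ys = a # ys'"
    using Cons.prems by (cases ys) (auto simp: walk_def)
  have dx: "distinct (a # xs)" and dy: "distinct (a # ys')"
    using nonbacktracking_walk_distinct[OF assms(1)] Cons.prems ys by blast+
  show ?case
  proof (cases "xs = [] \<or> ys' = []")
    case True
    then show ?thesis using dx dy Cons.prems(6) ys by (metis distinct.simps(2) last.simps last_in_set)
  next
    case False
    then have ne: "xs \<noteq> []" "ys' \<noteq> []" by auto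
    have w: "walk T xs" "walk T ys'" "nonbacktracking xs" "nonbacktracking ys'"
      using walk_ConsD[OF Cons.prems(1) ne(1)] walk_ConsD[OF Cons.prems(3)[unfolded ys] ne(2)]
        nonbacktracking_ConsD[OF Cons.prems(2)] nonbacktracking_ConsD[OF Cons.prems(4)[unfolded ys]]
      by auto
    have l: "last xs = last ys'" using Cons.prems(6) ne ys by simp
    have "hd xs = hd ys'"
    proof (rule ccontr)
      assume h: "hd xs \<noteq> hd ys'"
      have nb: "nonbacktracking (rev xs @ a # ys')"
        by (rule nonbacktracking_rev_join[OF Cons.prems(2) Cons.prems(4)[unfolded ys] ne h])
      have "successively (\<lambda>u v. {u, v} \<in> edges T) (rev xs)"
        using w(1) by (auto simp: walk_def insert_commute elim: successively_mono)
      moreover have "{last (rev xs), a} \<in> edges T"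
        using Cons.prems(1) ne by (auto simp: walk_def successively_Cons last_rev insert_commute)
      ultimately have "walk T (rev xs @ a # ys')"
        using Cons.prems(1,3) unfolding ys walk_def successively_append_iff by simp
      then have "distinct (rev xs @ a # ys')"
        using nonbacktracking_walk_distinct[OF assms(1)] nb by blast
      then show False using l ne by (auto dest: last_in_set)
    qed
    then show ?thesis using Cons.IH[OF w(1,3,2,4) _ l] ys by simp
  qed
qed

text \<open>Loop erasure: cut out the stretch between two occurrences of a vertex and recurse on the
  length. The relation \<open>R\<close> is arbitrary so that it can also record that every traversed
  edge belongs to a given edge path.\<close>

lemma walk_reduce_distinct:
  assumes "successively R xs" "xs \<noteq> []"
  shows "\<exists>ys. successively R ys \<and> ys \<noteq> [] \<and> set ys \<subseteq> set xs \<and> distinct ys \<and>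
    hd ys = hd xs \<and> last ys = last xs"
  using assms
proof (induction "length xs" arbitrary: xs rule: less_induct)
  case less
  show ?case
  proof (cases "distinct xs")
    case False
    then obtain us a vs ws where xs: "xs = us @ [a] @ vs @ [a] @ ws"
      using not_distinct_decomp by blast
    define zs where "zs = us @ [a] @ ws"
    have "successively R zs" "zs \<noteq> []" "length zs < length xs" "set zs \<subseteq> set xs"
        "hd zs = hd xs" "last zs = last xs"
      using less.prems by (auto simp: xs zs_def successively_append_iff successively_Cons hd_append)
    then show ?thesis using less.hyps[of zs] by (metis subset_trans)
  qed (use less.prems in blast)
qed

section \<open>Boundary rays, the order on edges, and subtrees\<close>

context
  fixes T :: "'v rtree"
  assumes T: "rooted_tree T"
begin

lemma is_tree: "is_tree T"
  using T by (simp add: rooted_tree_def)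

text \<open>Fixes the vertex sequence behind a ray. It must start at the root vertex: if that were
  \<open>x 1\<close>, the edge \<open>\<xi> 1\<close> would contain the root vertex and hence equal
  the root edge, against injectivity of \<open>x\<close>.\<close>

lemma boundary_vertices:
  assumes "\<xi> \<in> boundary T"
  obtains x where "\<And>n. x n \<in> verts T" "\<And>n. \<xi> n = {x n, x (Suc n)}" "\<And>n. \<xi> n \<in> edges T"
    "\<And>m n. walk T (map x [m..<Suc (m + n)]) \<and> nonbacktracking (map x [m..<Suc (m + n)])"
    "inj x" "root_vertex T = x 0"
proof -
  obtain x where x: "\<And>n. x n \<in> verts T" "\<And>n. \<xi> n = {x n, x (Suc n)}" "\<And>n. \<xi> n \<in> edges T"
      "\<And>n. x (Suc (Suc n)) \<noteq> x n" and 0: "\<xi> 0 = root_edge T"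
    using assms unfolding boundary_def mem_Collect_eq by metis
  have w: "walk T (map x [m..<Suc (m + n)]) \<and> nonbacktracking (map x [m..<Suc (m + n)])" for m n
    using x x(3)[unfolded x(2)]
    by (auto simp: walk_def nonbacktracking_def successively_conv_nth simp del: upt_Suc)
      (metis)
  have "inj x"
  proof (rule linorder_injI)
    fix i j :: nat assume "i < j"
    have "distinct (map x [0..<Suc (0 + j)])"
      using nonbacktracking_walk_distinct[OF is_tree] w by blast
    then have "inj_on x {0..j}"
      by (simp only: distinct_map set_upt atLeastLessThanSuc_atLeastAtMost add_0)
    then show "x i \<noteq> x j" using \<open>i < j\<close> by (auto dest: inj_onD)
  qed
  moreover have "root_vertex T = x 0"
  proof (rule ccontr)
    assume "root_vertex T \<noteq> x 0"
    then have "root_vertex T = x 1"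
      using T 0 x(2)[of 0] by (auto simp: rooted_tree_def)
    then have "\<xi> 1 = \<xi> 0"
      using T 0 x(2)[of 1] x(3)[of 1] by (auto simp: rooted_tree_def)
    then have "x 2 \<in> {x 0, x 1}" using x(2)[of 1] x(2)[of 0] by (auto simp: numeral_2_eq_2)
    then show False using \<open>inj x\<close> by (auto dest: injD)
  qed
  ultimately show ?thesis using that x w by blast
qed

lemma boundary_inj:
  assumes "\<xi> \<in> boundary T"
  shows "inj \<xi>"
proof -
  obtain x where x: "\<And>n. \<xi> n = {x n, x (Suc n)}" "inj x"
    using boundary_vertices[OF assms] by metis
  show ?thesis
    by (rule injI) (use x in \<open>auto simp: doubleton_eq_iff inj_eq\<close>)
qed

lemma boundary_edges: "\<xi> \<in> boundary T \<Longrightarrow> \<xi> n \<in> edges T"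
  using boundary_vertices by metis

text \<open>An edge path comes from a walk that may backtrack. Loop erasure makes the walk distinct
  without leaving the edges of \<open>es\<close>, and uniqueness then identifies it with a segment
  of the ray.\<close>

lemma edge_path_covers_ray:
  assumes \<xi>: "\<xi> \<in> boundary T" and es: "edge_path T (root_edge T) es (\<xi> k)"
  shows "\<xi> ` {..k} \<subseteq> set es"
proof -
  obtain x where x: "\<And>n. x n \<in> verts T" "\<And>n. \<xi> n = {x n, x (Suc n)}" "\<And>n. \<xi> n \<in> edges T"
    "\<And>m n. walk T (map x [m..<Suc (m + n)])" "\<And>m n. nonbacktracking (map x [m..<Suc (m + n)])"
    "inj x" "root_vertex T = x 0"
    using boundary_vertices[OF \<xi>] by metis
  obtain xs where xs: "walk T xs" and es_eq: "es = walk_edges xs" and ne: "es \<noteq> []"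
    and h: "hd es = root_edge T" and l: "last es = \<xi> k"
    using es unfolding edge_path_def by blast
  have len: "Suc 0 < length xs" "length es = length xs - 1"
    using ne by (cases xs; cases "tl xs"; auto simp: es_eq walk_edges_def)+
  have es_nth: "es ! i = {xs ! i, xs ! Suc i}" if "Suc i < length xs" for i
    using that by (simp add: es_eq walk_edges_def nth_tl)
  have root: "root_edge T = \<xi> 0" using \<xi> by (simp add: boundary_def)
  have succ: "successively (\<lambda>u v. {u, v} \<in> edges T \<and> {u, v} \<in> set es) xs"
    unfolding successively_conv_nth
  proof (intro allI impI)
    fix i assume i: "Suc i < length xs"
    have "{xs ! i, xs ! Suc i} \<in> edges T"
      using xs i unfolding walk_def successively_conv_nth by blast
    moreover have "es ! i \<in> set es" using i len by (intro nth_mem) auto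
    ultimately show "{xs ! i, xs ! Suc i} \<in> edges T \<and> {xs ! i, xs ! Suc i} \<in> set es"
      using es_nth[OF i] by simp
  qed
  then obtain ys where ys: "successively (\<lambda>u v. {u, v} \<in> edges T \<and> {u, v} \<in> set es) ys"
     "ys \<noteq> []" "set ys \<subseteq> set xs" "distinct ys" "hd ys = hd xs" "last ys = last xs"
    using walk_reduce_distinct[OF succ] xs unfolding walk_def by blast
  have wys: "walk T ys"
    using ys(2) subset_trans[OF ys(3)] xs
      successively_mono[OF ys(1), of "\<lambda>u v. {u, v} \<in> edges T"]
    unfolding walk_def by simp
  \<comment> \<open>The walk may cross its first and last edges in either direction. The reduced
    walk is therefore only known to run from \<open>x 0\<close> or \<open>x 1\<close> to
    \<open>x k\<close> or \<open>x (Suc k)\<close>; the edges \<open>\<xi> 0\<close> and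
    \<open>\<xi> k\<close> are supplied separately, as the head and the last element of
    \<open>es\<close>.\<close>
  have "hd xs \<in> {x 0, x 1}"
  proof -
    have "hd es = {xs ! 0, xs ! 1}" using es_nth[of 0] len ne by (simp add: hd_conv_nth)
    moreover have "hd xs = xs ! 0" using len(1) by (intro hd_conv_nth) auto
    ultimately have "hd xs \<in> \<xi> 0" using h root by simp
    then show ?thesis using x(2)[of 0] by simp
  qed
  then obtain i where i: "hd xs = x i" "i \<le> 1"
    using that[of 0] that[of 1] by blast
  have "last xs \<in> {x k, x (Suc k)}"
  proof -
    obtain m where m: "length xs = Suc (Suc m)"
      using len(1) that[of "length xs - 2"] by linarith
    then have "xs \<noteq> []" "length es = Suc m" using len(2) by auto
    then have "last es = {xs ! m, xs ! Suc m}" "last xs = xs ! Suc m"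
      using es_nth[of m] m ne by (simp_all add: last_conv_nth)
    then have "last xs \<in> \<xi> k" using l by simp
    then show ?thesis using x(2)[of k] by simp
  qed
  then obtain j where j: "last xs = x j" "k \<le> j"
    using that[of k] that[of "Suc k"] by auto
  have mid: "\<xi> n \<in> set es" if n: "i \<le> n" "n < j" for n
  proof -
    obtain d where d: "j = i + d" using n le_Suc_ex[of i j] by auto
    have "ys = map x [i..<Suc (i + d)]"
      using ys(5,6) i j d distinct_imp_nonbacktracking[OF ys(4)]
      by (intro nonbacktracking_walk_unique[OF is_tree wys _ x(4,5)])
        (simp_all add: hd_map last_map del: upt_Suc)
    then have "successively (\<lambda>u v. {u, v} \<in> edges T \<and> {u, v} \<in> set es) (map x [i..<Suc j])"
      using ys(1) d by simp
    then have "{map x [i..<Suc j] ! (n - i), map x [i..<Suc j] ! Suc (n - i)} \<in> set es"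
      using n successively_nth[of "\<lambda>u v. {u, v} \<in> edges T \<and> {u, v} \<in> set es"
          "map x [i..<Suc j]" "n - i"] by (simp del: upt_Suc add: less_diff_conv)
    then show ?thesis using n x(2)[of n] by (simp del: upt_Suc add: Suc_diff_le)
  qed
  show ?thesis
  proof (intro image_subsetI)
    fix n assume n: "n \<in> {..k}"
    consider "n = 0" | "n = k" | "1 \<le> n" "n < k" using n by fastforce
    then show "\<xi> n \<in> set es"
    proof cases
      case 1 then show ?thesis using h ne root by (metis hd_in_set)
    next
      case 2 then show ?thesis using l ne by (metis last_in_set)
    next
      case 3 then show ?thesis using mid i j by auto
    qed
  qed
qed

lemma edge_path_ray_prefix:
  assumes "\<xi> \<in> boundary T"
  shows "edge_path T (root_edge T) (map \<xi> [0..<Suc k]) (\<xi> k)"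
proof -
  obtain x where x: "\<And>n. \<xi> n = {x n, x (Suc n)}"
    "\<And>m n. walk T (map x [m..<Suc (m + n)])"
    using boundary_vertices[OF assms] by metis
  have w: "walk T (map x [0..<Suc (Suc k)])" using x(2)[of 0 "Suc k"] by simp
  have "map \<xi> [0..<Suc k] = walk_edges (map x [0..<Suc (Suc k)])"
    by (rule nth_equalityI) (auto simp: walk_edges_def x(1) nth_tl simp del: upt_Suc)
  moreover have "hd (map \<xi> [0..<Suc k]) = root_edge T"
    using assms by (simp add: hd_map boundary_def del: upt_Suc)
  moreover have "map \<xi> [0..<Suc k] \<noteq> []" "last (map \<xi> [0..<Suc k]) = \<xi> k"
    by simp_all
  ultimately show ?thesis unfolding edge_path_def using w by blast
qed

text \<open>The first \<open>Suc k\<close> edges of a ray are distinct and occur in every edge path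
  to \<open>\<xi> k\<close>, so they form a shortest path, and by counting any other shortest path
  has the same edge set.\<close>

lemma edge_le_ray_iff:
  assumes \<xi>: "\<xi> \<in> boundary T"
  shows "edge_le T \<alpha> (\<xi> k) \<longleftrightarrow> \<alpha> \<in> \<xi> ` {..k}"
proof -
  have card: "card (\<xi> ` {..k}) = Suc k"
    using boundary_inj[OF \<xi>] by (simp add: card_image inj_on_subset)
  have "Suc k \<le> length es" if "edge_path T (root_edge T) es (\<xi> k)" for es
    using card_mono[OF _ edge_path_covers_ray[OF \<xi> that]] card card_length[of es] by simp
  then have shortest: "shortest_edge_path T (root_edge T) (map \<xi> [0..<Suc k]) (\<xi> k)"
    using edge_path_ray_prefix[OF \<xi>] by (auto simp: shortest_edge_path_def simp del: upt_Suc)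
  have "set es = \<xi> ` {..k}" if es: "shortest_edge_path T (root_edge T) es (\<xi> k)" for es
  proof -
    have "length es \<le> Suc k" "\<xi> ` {..k} \<subseteq> set es"
      using es edge_path_ray_prefix[OF \<xi>, of k] edge_path_covers_ray[OF \<xi>]
      by (auto simp: shortest_edge_path_def)
    then show ?thesis
      using card card_length[of es] card_subset_eq[of "set es" "\<xi> ` {..k}"]
      by (metis List.finite_set card_mono le_antisym order.trans)
  qed
  then show ?thesis using shortest unfolding edge_le_def by blast
qed

text \<open>The edges preceding a given edge depend only on that edge, by
  \<open>edge_le_ray_iff\<close>; counting them recovers the index at which a ray passes through
  it.\<close>

lemma rays_through_common_edge:
  assumes \<xi>: "\<xi> \<in> boundary T" and \<zeta>: "\<zeta> \<in> boundary T" and eq: "\<xi> j = \<zeta> n"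
  shows "j = n" "\<xi> ` {..<n} = \<zeta> ` {..<n}"
proof -
  have e: "\<xi> ` {..j} = \<zeta> ` {..n}"
    using edge_le_ray_iff[OF \<xi>, of _ j] edge_le_ray_iff[OF \<zeta>, of _ n] eq by auto
  have inj: "inj \<xi>" "inj \<zeta>" using boundary_inj \<xi> \<zeta> by auto
  have "card {..j} = card {..n}"
    using arg_cong[OF e, of card] inj by (metis card_image inj_on_subset subset_UNIV)
  then show j: "j = n" by simp
  have "\<eta> ` {..<n} = \<eta> ` {..n} - {\<eta> n}" if "inj \<eta>" for \<eta> :: "nat \<Rightarrow> 'v set"
    using that by (simp add: lessThan_Suc_atMost[symmetric] lessThan_Suc image_insert inj_image_mem_iff)
  then show "\<xi> ` {..<n} = \<zeta> ` {..<n}" using inj e eq j by metis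
qed

lemma ray_mem_subtree_iff:
  assumes "\<xi> \<in> boundary T"
  shows "\<xi> k \<in> subtree_edges T \<alpha> \<longleftrightarrow> \<alpha> \<in> \<xi> ` {..k}"
  by (simp add: subtree_edges_def boundary_edges[OF assms] edge_le_ray_iff[OF assms])

lemma ray_subtree_through:
  assumes \<xi>: "\<xi> \<in> boundary T"
  shows "range \<xi> \<inter> subtree_edges T (\<xi> n) = \<xi> ` {n..}"
proof -
  have "\<xi> k \<in> subtree_edges T (\<xi> n) \<longleftrightarrow> n \<le> k" for k
    using ray_mem_subtree_iff[OF \<xi>] by (simp add: inj_image_mem_iff[OF boundary_inj[OF \<xi>]])
  then show ?thesis by auto
qed

lemma ray_subtree_disjoint:
  assumes \<xi>: "\<xi> \<in> boundary T" and "\<xi> \<notin> boundary_through T \<alpha>"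
  shows "range \<xi> \<inter> subtree_edges T \<alpha> = {}"
proof -
  have "\<alpha> \<notin> range \<xi>" using assms by (simp add: boundary_through_def)
  then have "\<xi> k \<notin> subtree_edges T \<alpha>" for k
    using ray_mem_subtree_iff[OF \<xi>, of k \<alpha>] by auto
  then show ?thesis by auto
qed

text \<open>Local finiteness enters here: a ray through \<open>\<zeta> n\<close> continues with an
  edge at one of the two endpoints of \<open>\<zeta> n\<close>, and both endpoints have finitely
  many neighbours.\<close>

lemma finite_ray_successors:
  assumes \<zeta>: "\<zeta> \<in> boundary T"
  shows "finite ((\<lambda>\<xi>. \<xi> (Suc n)) ` boundary_through T (\<zeta> n))"
proof -
  obtain z where z: "\<And>k. z k \<in> verts T" "\<And>k. \<zeta> k = {z k, z (Suc k)}"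
    using boundary_vertices[OF \<zeta>] by metis
  have fin: "finite {y. {v, y} \<in> edges T}" if "v \<in> verts T" for v
    using T that by (auto simp: rooted_tree_def locally_finite_def)
  have "(\<lambda>\<xi>. \<xi> (Suc n)) ` boundary_through T (\<zeta> n)
      \<subseteq> (\<Union>v\<in>{z n, z (Suc n)}. (\<lambda>y. {v, y}) ` {y. {v, y} \<in> edges T})"
  proof (intro image_subsetI)
    fix \<xi> assume "\<xi> \<in> boundary_through T (\<zeta> n)"
    then obtain j where \<xi>: "\<xi> \<in> boundary T" and j: "\<xi> j = \<zeta> n"
      unfolding boundary_through_def by auto
    have n: "\<xi> n = \<zeta> n" using rays_through_common_edge(1)[OF \<xi> \<zeta> j] j by simp
    obtain x where x: "\<And>k. \<xi> k = {x k, x (Suc k)}" "\<And>k. \<xi> k \<in> edges T"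
      using boundary_vertices[OF \<xi>] by metis
    have "x (Suc n) \<in> {z n, z (Suc n)}" using n x(1)[of n] z(2)[of n] by auto
    then show "\<xi> (Suc n) \<in> (\<Union>v\<in>{z n, z (Suc n)}. (\<lambda>y. {v, y}) ` {y. {v, y} \<in> edges T})"
      using x(1)[of "Suc n"] x(2)[of "Suc n"] by auto
  qed
  then show ?thesis
    by (rule finite_subset) (use fin z(1) in auto)
qed

end

section \<open>Real analysis\<close>

text \<open>Here \<open>a\<close> is the value on the top edge of a subtree, \<open>v\<close> the
  potential to be attained, \<open>r\<close> the energy below the top edge and \<open>c\<close> the
  capacity. Spending \<open>x\<close> on the top edge rescales the rest by
  \<open>(v - x) / (v - a)\<close>. Stationarity at \<open>x = a\<close> gives \<open>key\<close>,
  and inserting it into \<open>energy\<close> gives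
  \<open>v powr p * c = a powr (p - 1) * v\<close>.\<close>

lemma equilibrium_step_real:
  fixes a v r c p :: real
  assumes p: "1 < p" and a: "0 \<le> a" and v: "0 < v" and r: "0 \<le> r" and c: "0 \<le> c" "c < 1"
    and energy: "a powr p + r = v powr p * c"
    and min: "\<And>x. a < v \<Longrightarrow> 0 \<le> x \<Longrightarrow> x \<le> v \<Longrightarrow>
      a powr p + r \<le> x powr p + ((v - x) / (v - a)) powr p * r"
  shows "a < v" "a = v * c powr (1 / (p - 1))"
proof -
  have "v powr p * c < v powr p * 1" using c v by (intro mult_strict_left_mono) auto
  then have "a powr p < v powr p" using energy r by linarith
  then show av: "a < v" using powr_mono2[of p v a] v p by force
  have key: "r = a powr (p - 1) * (v - a)"
  proof (cases "a = 0")
    case True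
    \<comment> \<open>At the endpoint \<open>a = 0\<close> only competitors with
      \<open>x > 0\<close> are available, so the derivative test is replaced by a bound that tends
      to 0 with \<open>x\<close>.\<close>
    have le: "r \<le> v * x powr (p - 1)" if x: "0 < x" "x < v" for x
    proof -
      have "r \<le> x powr p + (1 - x / v) powr p * r"
        using min[OF av, of x] x v True p by (simp add: diff_divide_distrib)
      also have "(1 - x / v) powr p \<le> (1 - x / v) powr 1"
        using x v p by (intro powr_mono') auto
      also have "(1 - x / v) powr 1 = 1 - x / v" using x v by simp
      finally have "r \<le> x powr p + (1 - x / v) * r" using r by (simp add: mult_right_mono)
      then have "x * r \<le> v * x powr p" using v by (simp add: field_simps)
      also have "x powr p = x * x powr (p - 1)" using x by (simp add: powr_mult_base)
      finally show ?thesis using x by (simp add: mult.left_commute)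
    qed
    have "((\<lambda>x. v * x powr (p - 1)) \<longlongrightarrow> v * 0 powr (p - 1)) (at_right 0)"
      using p by (intro tendsto_mult tendsto_const tendsto_powr')
        (auto intro!: tendsto_ident_at eventually_at_rightI[of 0 1])
    moreover have "\<forall>\<^sub>F x in at_right 0. r \<le> v * x powr (p - 1)"
      using le v by (intro eventually_at_rightI[of 0 v]) auto
    ultimately have "r \<le> v * 0 powr (p - 1)"
      by (intro tendsto_lowerbound[of _ _ "at_right 0"]) auto
    then show ?thesis using True r p by simp
  next
    case False
    then have a0: "0 < a" using a by simp
    define \<phi> where "\<phi> x = x powr p + ((v - x) / (v - a)) powr p * r" for x
    \<comment> \<open>Within distance \<open>d\<close> of \<open>a\<close> all points stay in the
      interval from 0 to \<open>v\<close>, where \<open>min\<close> applies.\<close>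
    define d where "d = min a (v - a)"
    have "((\<lambda>x. (v - x) / (v - a)) has_real_derivative - 1 / (v - a)) (at a)"
      using av by (intro DERIV_cdivide) (auto intro!: derivative_eq_intros)
    from DERIV_fun_powr[OF this, of p]
    have "((\<lambda>x. ((v - x) / (v - a)) powr p) has_real_derivative - p / (v - a)) (at a)"
      using av by simp
    then have "(\<phi> has_real_derivative p * a powr (p - 1) + - p / (v - a) * r) (at a)"
      unfolding \<phi>_def by (intro DERIV_add DERIV_cmult_right has_real_derivative_powr a0)
    then have "(\<phi> has_real_derivative p * a powr (p - 1) - p * r / (v - a)) (at a)"
      by simp
    moreover have "0 < d" "\<forall>y. \<bar>a - y\<bar> < d \<longrightarrow> \<phi> a \<le> \<phi> y"
      using min[OF av] a0 av by (auto simp: d_def \<phi>_def)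
    ultimately have "p * a powr (p - 1) - p * r / (v - a) = 0"
      by (rule DERIV_local_min)
    then have "p * (a powr (p - 1) - r / (v - a)) = 0" by (simp add: right_diff_distrib)
    then have "a powr (p - 1) = r / (v - a)" using p by simp
    then show ?thesis using av by simp
  qed
  have "v powr p * c = a powr (p - 1) * v"
  proof -
    have "a powr p = a powr (p - 1) * a"
      using powr_mult_base[OF a, of "p - 1"] by (simp add: mult.commute)
    then show ?thesis using energy key by (simp add: algebra_simps)
  qed
  moreover have "v powr p = v powr (p - 1) * v"
    using powr_mult_base[of v "p - 1"] v by (simp add: mult.commute)
  ultimately have "v powr (p - 1) * c = a powr (p - 1)" using v by simp
  then have "(v powr (p - 1) * c) powr (1 / (p - 1)) = a"
    using a p by (simp add: powr_powr)
  then show "a = v * c powr (1 / (p - 1))"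
    using v c p by (simp add: powr_mult powr_powr)
qed

text \<open>Moving \<open>y\<close> from one edge to each of \<open>m\<close> successors saves at
  least \<open>y\<close>, as \<open>(1 - y) powr p \<le> 1 - y\<close>, and costs
  \<open>m * y powr p\<close>, which is of higher order. The choice
  \<open>y powr (p - 1) = 1 / (m + 2)\<close> makes the cost smaller than \<open>y\<close> and keeps
  \<open>y < 1\<close> even for \<open>m = 0\<close>.\<close>

lemma exists_split_energy_less_1:
  fixes p :: real
  assumes "1 < p"
  obtains y where "0 < y" "y < 1" "(1 - y) powr p + real m * y powr p < 1"
proof -
  define y where "y = (1 / (real m + 2)) powr (1 / (p - 1))"
  have y0: "0 < y" by (simp add: y_def add_nonneg_pos)
  have yp: "y powr (p - 1) = 1 / (real m + 2)" using assms by (simp add: y_def powr_powr)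
  have "y < 1 powr (1 / (p - 1))" unfolding y_def using assms by (intro powr_less_mono2) auto
  then have y1: "y < 1" by simp
  have "(1 - y) powr p \<le> (1 - y) powr 1" using y0 y1 assms by (intro powr_mono') auto
  moreover have "real m * y powr p = y * (real m / (real m + 2))"
    using powr_mult_base[of y "p - 1"] y0 yp by (simp add: field_simps)
  moreover have "y * (real m / (real m + 2)) < y * 1"
    using y0 by (intro mult_strict_left_mono) auto
  ultimately have "(1 - y) powr p + real m * y powr p < 1" using y1 by simp
  then show ?thesis using that y0 y1 by blast
qed

text \<open>Since \<open>u (Suc n) = u n * (1 - d n)\<close>, this is the convergence criterion for
  an infinite product, proved by comparing sums. If \<open>u\<close> stays above a positive limit,
  then \<open>d\<close> is dominated by a multiple of \<open>a\<close>; if a tail of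
  \<open>d\<close> sums to less than 1/2, that tail uses up less than half of
  \<open>u N\<close>.\<close>

lemma suminf_ne_1_iff_summable_ratio:
  fixes a d u :: "nat \<Rightarrow> real"
  assumes a: "\<And>n. 0 \<le> a n" and d: "\<And>n. 0 \<le> d n" and u: "\<And>n. u n = 1 - (\<Sum>k<n. a k)"
    and pos: "\<And>n. 0 < u n" and step: "\<And>n. a n = u n * d n"
  shows "summable a" "suminf a \<noteq> 1 \<longleftrightarrow> summable d"
proof -
  show sa: "summable a"
    using pos u a by (intro summableI_nonneg_bounded[of _ 1]) (auto simp: less_eq_real_def)
  have ule: "1 - suminf a \<le> u n" for n
    unfolding u using sum_le_suminf[OF sa, of "{..<n}"] a by simp
  show "suminf a \<noteq> 1 \<longleftrightarrow> summable d"
  proof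
    assume "suminf a \<noteq> 1"
    moreover have "suminf a \<le> 1"
      using pos u by (intro suminf_le_const[OF sa]) (simp add: less_eq_real_def)
    ultimately have l: "0 < 1 - suminf a" by simp
    have "d n \<le> a n / (1 - suminf a)" for n
      using mult_right_mono[OF ule d, of n n] l step[of n] by (simp add: field_simps)
    then show "summable d"
      using d sa by (intro summable_comparison_test[OF _ summable_divide[OF sa]]) auto
  next
    assume sd: "summable d"
    obtain N where N: "norm (\<Sum>i. d (i + N)) < 1 / 2"
      using suminf_exist_split[OF _ sd, of "1/2"] by auto
    have sd': "summable (\<lambda>i. d (i + N))" using sd by (simp add: summable_iff_shift)
    have anti: "u (i + N) \<le> u N" for i
      unfolding u using a by (auto intro!: sum_mono2)
    have "(\<Sum>i. a (i + N)) \<le> (\<Sum>i. u N * d (i + N))"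
    proof (rule suminf_le)
      show "a (i + N) \<le> u N * d (i + N)" for i
        using mult_right_mono[OF anti d] step by simp
      show "summable (\<lambda>i. a (i + N))" using sa by (simp add: summable_iff_shift)
      show "summable (\<lambda>i. u N * d (i + N))" using sd' by (rule summable_mult)
    qed
    also have "\<dots> = u N * (\<Sum>i. d (i + N))" using sd' by (rule suminf_mult)
    also have "\<dots> < u N * 1" using N pos by (intro mult_strict_left_mono) auto
    finally have "suminf a < 1"
      using suminf_split_initial_segment[OF sa, of N] u[of N] by simp
    then show "suminf a \<noteq> 1" by simp
  qed
qed

section \<open>Sums of nonnegative extended reals over arbitrary index sets\<close>

lemma summable_on_ennreal_any [simp]: "(f :: 'a \<Rightarrow> ennreal) summable_on A"
  by (rule nonneg_summable_on_complete) simp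

lemma infsum_cmult_ennreal:
  fixes f :: "'a \<Rightarrow> ennreal"
  shows "(\<Sum>\<^sub>\<infinity>x\<in>A. c * f x) = c * (\<Sum>\<^sub>\<infinity>x\<in>A. f x)"
proof -
  have "(\<Sum>\<^sub>\<infinity>x\<in>A. c * f x) = (SUP F\<in>{F. finite F \<and> F \<subseteq> A}. c * sum f F)"
    by (simp add: nonneg_infsum_complete sum_distrib_left)
  also have "\<dots> = c * (SUP F\<in>{F. finite F \<and> F \<subseteq> A}. sum f F)"
    by (rule SUP_mult_left_ennreal[symmetric])
  finally show ?thesis by (simp add: nonneg_infsum_complete)
qed

lemma infsum_mono_set_ennreal:
  fixes f :: "'a \<Rightarrow> ennreal"
  assumes "A \<subseteq> B" "\<And>x. x \<in> A \<Longrightarrow> f x \<le> g x"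
  shows "infsum f A \<le> infsum g B"
  using assms by (intro infsum_mono_neutral) auto

lemma infsum_powr_scale:
  fixes f :: "'a \<Rightarrow> real"
  assumes "0 \<le> t" "\<And>x. x \<in> A \<Longrightarrow> 0 \<le> f x"
  shows "(\<Sum>\<^sub>\<infinity>x\<in>A. ennreal ((t * f x) powr p))
    = ennreal (t powr p) * (\<Sum>\<^sub>\<infinity>x\<in>A. ennreal (f x powr p))"
proof -
  have "(\<Sum>\<^sub>\<infinity>x\<in>A. ennreal ((t * f x) powr p))
      = (\<Sum>\<^sub>\<infinity>x\<in>A. ennreal (t powr p) * ennreal (f x powr p))"
    using assms by (intro infsum_cong) (simp add: powr_mult ennreal_mult')
  then show ?thesis by (simp add: infsum_cmult_ennreal)
qed

lemma infsum_ennreal_scale: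
  fixes f :: "'a \<Rightarrow> real"
  assumes "0 \<le> t"
  shows "(\<Sum>\<^sub>\<infinity>x\<in>A. ennreal (t * f x)) = ennreal t * (\<Sum>\<^sub>\<infinity>x\<in>A. ennreal (f x))"
  using assms by (simp add: ennreal_mult' infsum_cmult_ennreal)

lemma infsum_range_eq_suminf:
  fixes g :: "'a \<Rightarrow> ennreal"
  assumes "inj \<xi>"
  shows "infsum g (range \<xi>) = (\<Sum>n. g (\<xi> n))"
proof -
  have "((\<lambda>n::nat. g (\<xi> n)) has_sum infsum (\<lambda>n. g (\<xi> n)) UNIV) UNIV"
    by (rule has_sum_infsum) simp
  then have "infsum (\<lambda>n. g (\<xi> n)) UNIV = (\<Sum>n. g (\<xi> n))"
    using has_sum_imp_sums sums_unique by blast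
  then show ?thesis using infsum_reindex[OF assms, of g] by (simp add: comp_def)
qed

section \<open>Capacities\<close>

text \<open>Common form of \<open>capacity\<close> and \<open>subtree_capacity\<close>: with the
  edge set \<open>D\<close> as a parameter, the comparison lemmas serve the whole tree and its
  subtrees alike.\<close>

definition relative_capacity :: "'e set \<Rightarrow> real \<Rightarrow> (nat \<Rightarrow> 'e) set \<Rightarrow> ennreal" where
  "relative_capacity D p F =
     Inf {\<Sum>\<^sub>\<infinity>\<beta>\<in>D. ennreal (f \<beta> powr p) | f.
            (\<forall>\<beta>\<in>D. 0 \<le> f \<beta>) \<and> (\<forall>\<xi>\<in>F. 1 \<le> (\<Sum>\<^sub>\<infinity>\<beta>\<in>range \<xi> \<inter> D. ennreal (f \<beta>)))}"

lemma relative_capacity_le: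
  assumes "\<And>\<beta>. \<beta> \<in> D \<Longrightarrow> 0 \<le> h \<beta>" "\<And>\<xi>. \<xi> \<in> F \<Longrightarrow> 1 \<le> (\<Sum>\<^sub>\<infinity>\<beta>\<in>range \<xi> \<inter> D. ennreal (h \<beta>))"
  shows "relative_capacity D p F \<le> (\<Sum>\<^sub>\<infinity>\<beta>\<in>D. ennreal (h \<beta> powr p))"
  unfolding relative_capacity_def using assms by (intro Inf_lower) blast

lemma relative_capacity_less:
  assumes "relative_capacity D p F < e"
  obtains g where "\<And>\<beta>. \<beta> \<in> D \<Longrightarrow> 0 \<le> g \<beta>"
    "\<And>\<xi>. \<xi> \<in> F \<Longrightarrow> 1 \<le> (\<Sum>\<^sub>\<infinity>\<beta>\<in>range \<xi> \<inter> D. ennreal (g \<beta>))"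
    "(\<Sum>\<^sub>\<infinity>\<beta>\<in>D. ennreal (g \<beta> powr p)) < e"
  using assms unfolding relative_capacity_def Inf_less_iff by blast

lemma relative_capacity_mono:
  assumes "F \<subseteq> G"
  shows "relative_capacity D p F \<le> relative_capacity D p G"
  unfolding relative_capacity_def using assms by (intro Inf_superset_mono) blast

text \<open>Since \<open>max(h, g)\<^sup>p \<le> h\<^sup>p + g\<^sup>p\<close>, taking maxima absorbs a null set without any use of
  Minkowski's inequality.\<close>

lemma relative_capacity_le_off_null:
  assumes h: "\<And>\<beta>. \<beta> \<in> D \<Longrightarrow> 0 \<le> h \<beta>"
    and adm: "\<And>\<xi>. \<xi> \<in> F - N \<Longrightarrow> 1 \<le> (\<Sum>\<^sub>\<infinity>\<beta>\<in>range \<xi> \<inter> D. ennreal (h \<beta>))"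
    and null: "relative_capacity D p (F \<inter> N) = 0"
  shows "relative_capacity D p F \<le> (\<Sum>\<^sub>\<infinity>\<beta>\<in>D. ennreal (h \<beta> powr p))"
proof (rule ennreal_le_epsilon)
  fix e :: real assume "0 < e"
  then obtain g where g: "\<And>\<beta>. \<beta> \<in> D \<Longrightarrow> 0 \<le> g \<beta>"
    "\<And>\<xi>. \<xi> \<in> F \<inter> N \<Longrightarrow> 1 \<le> (\<Sum>\<^sub>\<infinity>\<beta>\<in>range \<xi> \<inter> D. ennreal (g \<beta>))"
    "(\<Sum>\<^sub>\<infinity>\<beta>\<in>D. ennreal (g \<beta> powr p)) < ennreal e"
    using relative_capacity_less[of D p "F \<inter> N" "ennreal e"] null
    by (metis ennreal_less_zero_iff)
  define m where "m \<beta> = max (h \<beta>) (g \<beta>)" for \<beta>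
  have "relative_capacity D p F \<le> (\<Sum>\<^sub>\<infinity>\<beta>\<in>D. ennreal (m \<beta> powr p))"
  proof (rule relative_capacity_le)
    show "0 \<le> m \<beta>" if "\<beta> \<in> D" for \<beta> using h[OF that] by (simp add: m_def)
    fix \<xi> assume \<xi>: "\<xi> \<in> F"
    have "(\<Sum>\<^sub>\<infinity>\<beta>\<in>range \<xi> \<inter> D. ennreal (h \<beta>)) \<le> (\<Sum>\<^sub>\<infinity>\<beta>\<in>range \<xi> \<inter> D. ennreal (m \<beta>))"
      "(\<Sum>\<^sub>\<infinity>\<beta>\<in>range \<xi> \<inter> D. ennreal (g \<beta>)) \<le> (\<Sum>\<^sub>\<infinity>\<beta>\<in>range \<xi> \<inter> D. ennreal (m \<beta>))"
      by (auto intro!: infsum_mono_set_ennreal ennreal_leI simp: m_def)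
    then show "1 \<le> (\<Sum>\<^sub>\<infinity>\<beta>\<in>range \<xi> \<inter> D. ennreal (m \<beta>))"
      using adm[of \<xi>] g(2)[of \<xi>] \<xi> by (cases "\<xi> \<in> N") (auto intro: order.trans)
  qed
  also have "\<dots> \<le> (\<Sum>\<^sub>\<infinity>\<beta>\<in>D. ennreal (h \<beta> powr p) + ennreal (g \<beta> powr p))"
  proof (rule infsum_mono_set_ennreal)
    fix \<beta> assume "\<beta> \<in> D"
    have "m \<beta> powr p \<le> h \<beta> powr p + g \<beta> powr p" by (simp add: m_def max_def)
    then show "ennreal (m \<beta> powr p) \<le> ennreal (h \<beta> powr p) + ennreal (g \<beta> powr p)"
      by (simp flip: ennreal_plus)
  qed simp
  also have "\<dots> = (\<Sum>\<^sub>\<infinity>\<beta>\<in>D. ennreal (h \<beta> powr p)) + (\<Sum>\<^sub>\<infinity>\<beta>\<in>D. ennreal (g \<beta> powr p))"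
    by (rule infsum_add) simp_all
  also have "\<dots> \<le> (\<Sum>\<^sub>\<infinity>\<beta>\<in>D. ennreal (h \<beta> powr p)) + ennreal e"
    using g(3) by (intro add_left_mono) simp
  finally show "relative_capacity D p F \<le> (\<Sum>\<^sub>\<infinity>\<beta>\<in>D. ennreal (h \<beta> powr p)) + ennreal e" .
qed

text \<open>The indicator of \<open>\<alpha>\<close> is admissible. Applied to the root edge, this
  makes the energy of an equilibrium function finite.\<close>

lemma relative_capacity_le_1:
  assumes "\<alpha> \<in> D" "\<And>\<xi>. \<xi> \<in> F \<Longrightarrow> \<alpha> \<in> range \<xi>"
  shows "relative_capacity D p F \<le> 1"
proof -
  define h where "h \<beta> = (if \<beta> = \<alpha> then 1 else 0 :: real)" for \<beta>
  have single: "(\<Sum>\<^sub>\<infinity>\<beta>\<in>A. ennreal (h \<beta>)) = 1" "(\<Sum>\<^sub>\<infinity>\<beta>\<in>A. ennreal (h \<beta> powr p)) = 1" if "\<alpha> \<in> A" for A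
    using that infsum_cong_neutral[of "{\<alpha>}" A "\<lambda>\<beta>. ennreal (h \<beta>)" "\<lambda>\<beta>. ennreal (h \<beta>)"]
      infsum_cong_neutral[of "{\<alpha>}" A "\<lambda>\<beta>. ennreal (h \<beta> powr p)" "\<lambda>\<beta>. ennreal (h \<beta> powr p)"]
    by (auto simp: h_def)
  have "relative_capacity D p F \<le> (\<Sum>\<^sub>\<infinity>\<beta>\<in>D. ennreal (h \<beta> powr p))"
  proof (rule relative_capacity_le)
    show "0 \<le> h \<beta>" for \<beta> by (simp add: h_def)
    show "1 \<le> (\<Sum>\<^sub>\<infinity>\<beta>\<in>range \<xi> \<inter> D. ennreal (h \<beta>))" if "\<xi> \<in> F" for \<xi>
      using single(1)[of "range \<xi> \<inter> D"] assms(1) assms(2)[OF that] by simp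
  qed
  then show ?thesis using single assms by simp
qed

section \<open>Passing between the whole tree and a subtree\<close>

lemma boundary_through_nth:
  assumes "rooted_tree T" "\<zeta> \<in> boundary T" "\<xi> \<in> boundary_through T (\<zeta> n)"
  shows "\<xi> \<in> boundary T" "\<xi> n = \<zeta> n" "\<xi> ` {..<n} = \<zeta> ` {..<n}"
proof -
  obtain j where j: "\<xi> j = \<zeta> n" and \<xi>: "\<xi> \<in> boundary T"
    using assms(3) unfolding boundary_through_def by auto
  show "\<xi> \<in> boundary T" by (rule \<xi>)
  show "\<xi> n = \<zeta> n" "\<xi> ` {..<n} = \<zeta> ` {..<n}"
    using rays_through_common_edge[OF assms(1) \<xi> assms(2) j] j by simp_all
qed

text \<open>A ray through \<open>\<zeta> n\<close> shares its earlier edges with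
  \<open>\<zeta>\<close> and enters the subtree at index \<open>n\<close>. The edge
  \<open>\<zeta> n\<close> itself is counted in the subtree part.\<close>

lemma ray_sum_split:
  fixes G :: "'v set \<Rightarrow> ennreal"
  assumes T: "rooted_tree T" and \<zeta>: "\<zeta> \<in> boundary T" and \<xi>: "\<xi> \<in> boundary_through T (\<zeta> n)"
  shows "infsum G (range \<xi>) = (\<Sum>k<n. G (\<zeta> k)) + infsum G (range \<xi> \<inter> subtree_edges T (\<zeta> n))"
proof -
  note b = boundary_through_nth[OF T \<zeta> \<xi>]
  have inj: "inj \<xi>" "inj \<zeta>" using boundary_inj[OF T] b(1) \<zeta> by auto
  have D: "range \<xi> \<inter> subtree_edges T (\<zeta> n) = \<xi> ` {n..}"
    using ray_subtree_through[OF T b(1), of n] b(2) by simp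
  have "range \<xi> = \<xi> ` {..<n} \<union> \<xi> ` {n..}"
    by (metis (no_types) UNIV_eq_I Un_iff atLeast_iff image_Un lessThan_iff not_le)
  moreover have "\<xi> ` {..<n} \<inter> \<xi> ` {n..} = {}"
    using inj(1) by (auto simp: inj_eq)
  ultimately have "infsum G (range \<xi>) = infsum G (\<xi> ` {..<n}) + infsum G (\<xi> ` {n..})"
    using infsum_Un_disjoint[of G "\<xi> ` {..<n}" "\<xi> ` {n..}"] by simp
  also have "infsum G (\<xi> ` {..<n}) = (\<Sum>k<n. G (\<zeta> k))"
    using inj(2) by (simp add: b(3) sum.reindex inj_on_subset)
  finally show ?thesis by (simp add: D)
qed

lemma capacity_eq_relative:
  assumes "rooted_tree T" "F \<subseteq> boundary T"
  shows "capacity T p F = relative_capacity (edges T) p F"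
proof -
  have "range \<xi> \<inter> edges T = range \<xi>" if "\<xi> \<in> F" for \<xi>
    using boundary_edges[OF assms(1)] assms(2) that by auto
  then show ?thesis
    unfolding capacity_def relative_capacity_def potential_def by simp
qed

lemma subtree_capacity_eq_relative:
  "subtree_capacity T \<alpha> p F = relative_capacity (subtree_edges T \<alpha>) p F"
  by (simp add: subtree_capacity_def relative_capacity_def)

lemma subtree_edges_subset: "subtree_edges T \<alpha> \<subseteq> edges T"
  by (auto simp: subtree_edges_def)

text \<open>A function of small energy on the whole tree is small on each of the \<open>n\<close>
  edges before \<open>\<zeta> n\<close>. If these carry at most half of the potential, doubling the
  function makes it admissible for the subtree, at the price of a factor
  \<open>2 powr p\<close>.\<close>

lemma relative_capacity_subtree_null:
  assumes T: "rooted_tree T" and p: "1 < p" and \<zeta>: "\<zeta> \<in> boundary T"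
    and N: "N \<subseteq> boundary_through T (\<zeta> n)" and null: "relative_capacity (edges T) p N = 0"
  shows "relative_capacity (subtree_edges T (\<zeta> n)) p N = 0"
proof -
  let ?D = "subtree_edges T (\<zeta> n)"
  have "relative_capacity ?D p N \<le> 0 + ennreal e" if e: "0 < e" for e
  proof -
    \<comment> \<open>With at most \<open>s\<close> on each of \<open>n\<close> edges the prefix
      carries at most 1/2, and the added 1 covers \<open>n = 0\<close>. The first bound in
      \<open>\<delta>\<close> forces \<open>g \<le> s\<close> along the ray; the second absorbs the
      factor \<open>2 powr p\<close>.\<close>
    define s where "s = 1 / (2 * (real n + 1))"
    define \<delta> where "\<delta> = min (s powr p) (e / 2 powr p)"
    have s: "0 < s" by (simp add: s_def add_nonneg_pos)
    have \<delta>: "0 < \<delta>" using s e by (simp add: \<delta>_def)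
    obtain g where g: "\<And>\<beta>. \<beta> \<in> edges T \<Longrightarrow> 0 \<le> g \<beta>"
      "\<And>\<xi>. \<xi> \<in> N \<Longrightarrow> 1 \<le> (\<Sum>\<^sub>\<infinity>\<beta>\<in>range \<xi> \<inter> edges T. ennreal (g \<beta>))"
      "(\<Sum>\<^sub>\<infinity>\<beta>\<in>edges T. ennreal (g \<beta> powr p)) < ennreal \<delta>"
      using relative_capacity_less[of "edges T" p N "ennreal \<delta>"] null \<delta>
      by (metis ennreal_less_zero_iff)
    have gs: "g (\<zeta> k) \<le> s" for k
    proof -
      have \<zeta>k: "\<zeta> k \<in> edges T" by (rule boundary_edges[OF T \<zeta>])
      have "ennreal (g (\<zeta> k) powr p) = (\<Sum>\<^sub>\<infinity>\<beta>\<in>{\<zeta> k}. ennreal (g \<beta> powr p))" by simp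
      also have "\<dots> \<le> (\<Sum>\<^sub>\<infinity>\<beta>\<in>edges T. ennreal (g \<beta> powr p))"
        using \<zeta>k by (intro infsum_mono_set_ennreal) auto
      finally have "ennreal (g (\<zeta> k) powr p) < ennreal \<delta>" using g(3) by (rule le_less_trans)
      then have "g (\<zeta> k) powr p < s powr p" by (auto simp: ennreal_less_iff \<delta>_def)
      then show ?thesis using s p powr_mono2[of p s "g (\<zeta> k)"] by force
    qed
    have prefix: "(\<Sum>k<n. g (\<zeta> k)) \<le> 1 / 2"
    proof -
      have "(\<Sum>k<n. g (\<zeta> k)) \<le> real n * s"
        using sum_bounded_above[of "{..<n}" "\<lambda>k. g (\<zeta> k)" s] gs by simp
      also have "\<dots> \<le> 1 / 2" by (simp add: s_def field_simps)
      finally show ?thesis .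
    qed
    have "relative_capacity ?D p N \<le> (\<Sum>\<^sub>\<infinity>\<beta>\<in>?D. ennreal ((2 * g \<beta>) powr p))"
    proof (rule relative_capacity_le)
      show "0 \<le> 2 * g \<beta>" if "\<beta> \<in> ?D" for \<beta> using g(1) that subtree_edges_subset by fastforce
      fix \<xi> assume \<xi>: "\<xi> \<in> N"
      define X where "X = (\<Sum>\<^sub>\<infinity>\<beta>\<in>range \<xi> \<inter> ?D. ennreal (g \<beta>))"
      have \<xi>t: "\<xi> \<in> boundary_through T (\<zeta> n)" using \<xi> N by blast
      have "range \<xi> \<inter> edges T = range \<xi>"
        using boundary_edges[OF T boundary_through_nth(1)[OF T \<zeta> \<xi>t]] by auto
      then have "1 \<le> (\<Sum>k<n. ennreal (g (\<zeta> k))) + X"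
        using g(2)[OF \<xi>] ray_sum_split[OF T \<zeta> \<xi>t, of "\<lambda>\<beta>. ennreal (g \<beta>)"] by (simp add: X_def)
      also have "(\<Sum>k<n. ennreal (g (\<zeta> k))) = ennreal (\<Sum>k<n. g (\<zeta> k))"
        using g(1) boundary_edges[OF T \<zeta>] by (intro sum_ennreal) auto
      also have "\<dots> \<le> ennreal (1 / 2)" using prefix by (rule ennreal_leI)
      finally have X: "1 \<le> ennreal (1 / 2) + X" by (simp add: add_right_mono)
      have "1 \<le> ennreal 2 * X"
      proof (cases X)
        case (real x)
        then have "1 \<le> 1 / 2 + x" using X by (simp flip: ennreal_plus ennreal_1 del: ennreal_half)
        then have "1 \<le> ennreal (2 * x)" by simp
        then show ?thesis using real by (simp add: ennreal_mult')
      qed (simp add: ennreal_mult_top)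
      then show "1 \<le> (\<Sum>\<^sub>\<infinity>\<beta>\<in>range \<xi> \<inter> ?D. ennreal (2 * g \<beta>))"
        using infsum_ennreal_scale[of 2 g] by (simp add: X_def)
    qed
    also have "\<dots> = ennreal (2 powr p) * (\<Sum>\<^sub>\<infinity>\<beta>\<in>?D. ennreal (g \<beta> powr p))"
      using g(1) subtree_edges_subset by (intro infsum_powr_scale) fastforce+
    also have "\<dots> \<le> ennreal (2 powr p) * ennreal \<delta>"
    proof (rule mult_left_mono)
      have "(\<Sum>\<^sub>\<infinity>\<beta>\<in>?D. ennreal (g \<beta> powr p)) \<le> (\<Sum>\<^sub>\<infinity>\<beta>\<in>edges T. ennreal (g \<beta> powr p))"
        by (intro infsum_mono_set_ennreal subtree_edges_subset) simp
      then show "(\<Sum>\<^sub>\<infinity>\<beta>\<in>?D. ennreal (g \<beta> powr p)) \<le> ennreal \<delta>" using g(3) by simp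
    qed simp
    also have "\<dots> = ennreal (2 powr p * \<delta>)" by (simp add: ennreal_mult')
    also have "\<dots> \<le> ennreal e"
    proof (rule ennreal_leI)
      have "2 powr p * \<delta> \<le> 2 powr p * (e / 2 powr p)" by (intro mult_left_mono) (auto simp: \<delta>_def)
      then show "2 powr p * \<delta> \<le> e" by simp
    qed
    finally show ?thesis by simp
  qed
  then have "relative_capacity ?D p N \<le> 0" by (rule ennreal_le_epsilon)
  then show ?thesis by simp
qed

text \<open>Placing \<open>1 - y\<close> on \<open>\<zeta> n\<close> and \<open>y\<close> on each of
  its finitely many successors is admissible and cheaper than placing 1 on \<open>\<zeta> n\<close>
  alone. The strict inequality is what keeps \<open>u\<close> positive along the geodesic.\<close>

lemma relative_capacity_subtree_less_1:
  assumes T: "rooted_tree T" and p: "1 < p" and \<zeta>: "\<zeta> \<in> boundary T"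
    and F: "F \<subseteq> boundary_through T (\<zeta> n)"
  shows "relative_capacity (subtree_edges T (\<zeta> n)) p F < 1"
proof -
  let ?D = "subtree_edges T (\<zeta> n)"
  define C where "C = (\<lambda>\<xi>. \<xi> (Suc n)) ` boundary_through T (\<zeta> n)"
  have fin: "finite C" unfolding C_def by (rule finite_ray_successors[OF T \<zeta>])
  have nC: "\<zeta> n \<notin> C"
    using boundary_through_nth[OF T \<zeta>] boundary_inj[OF T]
    unfolding C_def by (metis (no_types, lifting) imageE injD n_not_Suc_n)
  obtain y where y: "0 < y" "y < 1" "(1 - y) powr p + real (card C) * y powr p < 1"
    using exists_split_energy_less_1[OF p] by blast
  define h where "h \<beta> = (if \<beta> = \<zeta> n then 1 - y else if \<beta> \<in> C then y else 0)" for \<beta>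
  have "relative_capacity ?D p F \<le> (\<Sum>\<^sub>\<infinity>\<beta>\<in>?D. ennreal (h \<beta> powr p))"
  proof (rule relative_capacity_le)
    show "0 \<le> h \<beta>" for \<beta> using y by (simp add: h_def)
    fix \<xi> assume "\<xi> \<in> F"
    then have \<xi>t: "\<xi> \<in> boundary_through T (\<zeta> n)" using F by blast
    note b = boundary_through_nth[OF T \<zeta> \<xi>t]
    have D: "range \<xi> \<inter> ?D = \<xi> ` {n..}" using ray_subtree_through[OF T b(1), of n] b(2) by simp
    have ne: "\<xi> (Suc n) \<noteq> \<zeta> n" "\<xi> (Suc n) \<in> C" using nC \<xi>t by (auto simp: C_def)
    have "1 = ennreal (1 - y + y)" by simp
    also have "\<dots> = ennreal (1 - y) + ennreal y" using y by (intro ennreal_plus) auto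
    also have "\<dots> = (\<Sum>\<^sub>\<infinity>\<beta>\<in>{\<zeta> n, \<xi> (Suc n)}. ennreal (h \<beta>))"
      using ne by (simp add: h_def)
    also have "\<dots> \<le> (\<Sum>\<^sub>\<infinity>\<beta>\<in>range \<xi> \<inter> ?D. ennreal (h \<beta>))"
    proof (rule infsum_mono_set_ennreal)
      show "{\<zeta> n, \<xi> (Suc n)} \<subseteq> range \<xi> \<inter> ?D" unfolding D using b(2) by auto
    qed simp
    finally show "1 \<le> (\<Sum>\<^sub>\<infinity>\<beta>\<in>range \<xi> \<inter> ?D. ennreal (h \<beta>))" .
  qed
  \<comment> \<open>As \<open>h\<close> vanishes off \<open>insert (\<zeta> n) C\<close>, the finite
    sum is an upper bound wherever \<open>C\<close> lies.\<close>
  also have "\<dots> \<le> (\<Sum>\<^sub>\<infinity>\<beta>\<in>insert (\<zeta> n) C. ennreal (h \<beta> powr p))"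
    by (intro infsum_mono_neutral) (auto simp: h_def)
  also have "\<dots> = ennreal ((1 - y) powr p + real (card C) * y powr p)"
  proof -
    have "(\<Sum>\<beta>\<in>C. h \<beta> powr p) = (\<Sum>\<beta>\<in>C. y powr p)"
      using nC by (intro sum.cong) (auto simp: h_def)
    then have "(\<Sum>\<beta>\<in>insert (\<zeta> n) C. h \<beta> powr p) = (1 - y) powr p + real (card C) * y powr p"
      using fin nC by (simp add: h_def[of "\<zeta> n"])
    then show ?thesis using fin by (simp add: sum_ennreal del: sum.insert)
  qed
  also have "\<dots> < ennreal 1" using y(3) by (intro ennreal_lessI) auto
  finally show ?thesis by simp
qed

section \<open>The equilibrium function along a geodesic\<close>

locale equilibrium_ray =
  fixes T :: "'v rtree" and p :: real and E :: "(nat \<Rightarrow> 'v set) set"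
    and f :: "'v set \<Rightarrow> real" and \<zeta> :: "nat \<Rightarrow> 'v set"
  assumes T: "rooted_tree T" and p: "1 < p" and E: "E \<subseteq> boundary T"
    and eq: "equilibrium_function T p E f" and \<zeta>: "\<zeta> \<in> boundary T"
begin

definition u :: "nat \<Rightarrow> real" where
  "u n = 1 - (\<Sum>k<n. f (\<zeta> k))"

definition exceptional :: "(nat \<Rightarrow> 'v set) set" where
  "exceptional = {\<xi> \<in> E. potential f \<xi> \<noteq> 1}"

abbreviation D :: "nat \<Rightarrow> 'v set set" where
  "D n \<equiv> subtree_edges T (\<zeta> n)"

definition cap :: "nat \<Rightarrow> ennreal" where
  "cap n = relative_capacity (D n) p (E \<inter> boundary_through T (\<zeta> n))"

lemma f_nonneg: "\<alpha> \<in> edges T \<Longrightarrow> 0 \<le> f \<alpha>"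
  using eq by (simp add: equilibrium_function_def)

lemma f_ray_nonneg: "0 \<le> f (\<zeta> k)"
  using f_nonneg boundary_edges[OF T \<zeta>] .

lemma exceptional_null: "relative_capacity (edges T) p exceptional = 0"
proof -
  have "exceptional \<subseteq> boundary T" using E by (auto simp: exceptional_def)
  from capacity_eq_relative[OF T this, of p] show ?thesis
    using eq by (simp add: equilibrium_function_def exceptional_def)
qed

lemma energy_eq: "(\<Sum>\<^sub>\<infinity>\<alpha>\<in>edges T. ennreal (f \<alpha> powr p)) = relative_capacity (edges T) p E"
  using eq capacity_eq_relative[OF T E] by (simp add: equilibrium_function_def)

lemma energy_finite: "(\<Sum>\<^sub>\<infinity>\<alpha>\<in>A. ennreal (f \<alpha> powr p)) < \<infinity>" if "A \<subseteq> edges T"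
proof -
  have "root_edge T \<in> range \<xi>" if "\<xi> \<in> E" for \<xi>
    using that E by (metis (mono_tags, lifting) boundary_def mem_Collect_eq rangeI subsetD)
  moreover have "root_edge T \<in> edges T" using T by (simp add: rooted_tree_def)
  ultimately have "relative_capacity (edges T) p E \<le> 1" by (rule relative_capacity_le_1[rotated])
  then have "(\<Sum>\<^sub>\<infinity>\<alpha>\<in>A. ennreal (f \<alpha> powr p)) \<le> 1"
    using infsum_mono_set_ennreal[OF that order_refl, of "\<lambda>\<alpha>. ennreal (f \<alpha> powr p)"] energy_eq
    by simp
  then show ?thesis using le_less_trans[OF _ ennreal_one_less_top] by simp
qed

lemma range_edges: "\<xi> \<in> E \<Longrightarrow> range \<xi> \<inter> edges T = range \<xi>"
  using boundary_edges[OF T] E by auto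

lemma ray_notin_subtree: "k < n \<Longrightarrow> \<zeta> k \<notin> D n"
  using ray_mem_subtree_iff[OF T \<zeta>] inj_image_mem_iff[OF boundary_inj[OF T \<zeta>]] by simp

lemma ray_in_subtree: "\<zeta> n \<in> D n"
  using ray_mem_subtree_iff[OF T \<zeta>] by simp

text \<open>Replacing \<^term>\<open>f\<close> below \<open>\<zeta> n\<close> by \<open>u n\<close> times a competitor for the subtree
  does not lower the energy.\<close>

lemma energy_le_cap:
  assumes u0: "0 < u n"
  shows "(\<Sum>\<^sub>\<infinity>\<beta>\<in>D n. ennreal (f \<beta> powr p)) \<le> ennreal (u n powr p) * cap n"
proof -
  let ?S = "\<Sum>\<^sub>\<infinity>\<beta>\<in>D n. ennreal (f \<beta> powr p)"
  define R where "R = (\<Sum>\<^sub>\<infinity>\<beta>\<in>edges T - D n. ennreal (f \<beta> powr p))"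
  have step: "?S \<le> ennreal (u n powr p) * (\<Sum>\<^sub>\<infinity>\<beta>\<in>D n. ennreal (h \<beta> powr p))"
    if h0: "\<forall>\<beta>\<in>D n. 0 \<le> h \<beta>"
      and h1: "\<forall>\<xi>\<in>E \<inter> boundary_through T (\<zeta> n). 1 \<le> (\<Sum>\<^sub>\<infinity>\<beta>\<in>range \<xi> \<inter> D n. ennreal (h \<beta>))" for h
  proof -
    \<comment> \<open>Off the exceptional set, rays through \<open>\<zeta> n\<close> have collected
      \<open>1 - u n\<close> before reaching it, so a unit competitor scaled by \<open>u n\<close>
      supplies the rest; all other rays keep the potential of \<open>f\<close>.\<close>
    define F where "F \<beta> = (if \<beta> \<in> D n then u n * h \<beta> else f \<beta>)" for \<beta>
    have split: "infsum G (edges T) = infsum G (edges T - D n) + infsum G (D n)"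
      for G :: "'v set \<Rightarrow> ennreal"
      using infsum_Un_disjoint[of G "edges T - D n" "D n"] subtree_edges_subset[of T "\<zeta> n"]
      by (simp add: Un_absorb2 Diff_disjoint Int_commute)
    have "relative_capacity (edges T) p E \<le> (\<Sum>\<^sub>\<infinity>\<beta>\<in>edges T. ennreal (F \<beta> powr p))"
    proof (rule relative_capacity_le_off_null[where N = exceptional])
      show "0 \<le> F \<beta>" if "\<beta> \<in> edges T" for \<beta>
        using that h0 u0 f_nonneg by (simp add: F_def)
      have "E \<inter> exceptional = exceptional" by (auto simp: exceptional_def)
      then show "relative_capacity (edges T) p (E \<inter> exceptional) = 0"
        by (simp add: exceptional_null)
      fix \<xi> assume "\<xi> \<in> E - exceptional"
      then have \<xi>: "\<xi> \<in> E" and pot: "potential f \<xi> = 1" by (auto simp: exceptional_def)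
      show "1 \<le> (\<Sum>\<^sub>\<infinity>\<beta>\<in>range \<xi> \<inter> edges T. ennreal (F \<beta>))"
        unfolding range_edges[OF \<xi>]
      proof (cases "\<xi> \<in> boundary_through T (\<zeta> n)")
        case True
        define X where "X = (\<Sum>\<^sub>\<infinity>\<beta>\<in>range \<xi> \<inter> D n. ennreal (h \<beta>))"
        have "(\<Sum>\<^sub>\<infinity>\<beta>\<in>range \<xi>. ennreal (F \<beta>))
            = (\<Sum>k<n. ennreal (F (\<zeta> k))) + (\<Sum>\<^sub>\<infinity>\<beta>\<in>range \<xi> \<inter> D n. ennreal (F \<beta>))"
          by (rule ray_sum_split[OF T \<zeta> True])
        also have "(\<Sum>k<n. ennreal (F (\<zeta> k))) = ennreal (\<Sum>k<n. f (\<zeta> k))"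
          using ray_notin_subtree f_ray_nonneg by (simp add: F_def sum_ennreal)
        also have "(\<Sum>\<^sub>\<infinity>\<beta>\<in>range \<xi> \<inter> D n. ennreal (F \<beta>))
            = (\<Sum>\<^sub>\<infinity>\<beta>\<in>range \<xi> \<inter> D n. ennreal (u n * h \<beta>))"
          by (intro infsum_cong) (simp add: F_def)
        also have "\<dots> = ennreal (u n) * X"
          using u0 by (simp add: infsum_ennreal_scale X_def)
        finally have *: "(\<Sum>\<^sub>\<infinity>\<beta>\<in>range \<xi>. ennreal (F \<beta>)) = ennreal (1 - u n) + ennreal (u n) * X"
          by (simp add: u_def)
        have "1 = ennreal (1 - u n + u n)" by simp
        also have "\<dots> = ennreal (1 - u n) + ennreal (u n) * 1"
          using u0 f_ray_nonneg by (subst ennreal_plus) (auto simp: u_def sum_nonneg)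
        also have "\<dots> \<le> ennreal (1 - u n) + ennreal (u n) * X"
          using h1 True \<xi> by (intro add_left_mono mult_left_mono) (auto simp: X_def)
        finally show "1 \<le> (\<Sum>\<^sub>\<infinity>\<beta>\<in>range \<xi>. ennreal (F \<beta>))" by (simp add: *)
      next
        case False
        then have "range \<xi> \<inter> D n = {}" using ray_subtree_disjoint[OF T] \<xi> E by blast
        then have "(\<Sum>\<^sub>\<infinity>\<beta>\<in>range \<xi>. ennreal (F \<beta>)) = potential f \<xi>"
          unfolding potential_def by (intro infsum_cong) (auto simp: F_def)
        then show "1 \<le> (\<Sum>\<^sub>\<infinity>\<beta>\<in>range \<xi>. ennreal (F \<beta>))" using pot by simp
      qed
    qed
    also have "\<dots> = R + (\<Sum>\<^sub>\<infinity>\<beta>\<in>D n. ennreal ((u n * h \<beta>) powr p))"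
      unfolding split R_def by (intro arg_cong2[of _ _ _ _ "(+)"] infsum_cong) (auto simp: F_def)
    also have "(\<Sum>\<^sub>\<infinity>\<beta>\<in>D n. ennreal ((u n * h \<beta>) powr p))
        = ennreal (u n powr p) * (\<Sum>\<^sub>\<infinity>\<beta>\<in>D n. ennreal (h \<beta> powr p))"
      using u0 h0 by (intro infsum_powr_scale) auto
    finally have "R + ?S \<le> R + ennreal (u n powr p) * (\<Sum>\<^sub>\<infinity>\<beta>\<in>D n. ennreal (h \<beta> powr p))"
      using energy_eq split[of "\<lambda>\<alpha>. ennreal (f \<alpha> powr p)"] by (simp add: R_def)
    \<comment> \<open>The energy outside the subtree is the same on both sides and cancels because
      it is finite.\<close>
    moreover have "R < \<infinity>" unfolding R_def by (rule energy_finite) auto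
    ultimately show ?thesis using ennreal_add_left_cancel_le by auto
  qed
  have inv: "ennreal (u n powr p) * ennreal (1 / u n powr p) = 1"
    using u0 by (simp flip: ennreal_mult')
  \<comment> \<open>The scalar is moved to the left so that the bound can be passed to the infimum
    over competitors directly.\<close>
  have "ennreal (1 / u n powr p) * ?S \<le> cap n"
    unfolding cap_def relative_capacity_def
  proof (rule Inf_greatest, clarify)
    fix h assume "\<forall>\<beta>\<in>D n. 0 \<le> h \<beta>"
      "\<forall>\<xi>\<in>E \<inter> boundary_through T (\<zeta> n). 1 \<le> (\<Sum>\<^sub>\<infinity>\<beta>\<in>range \<xi> \<inter> D n. ennreal (h \<beta>))"
    from mult_left_mono[OF step[OF this], of "ennreal (1 / u n powr p)"]
    show "ennreal (1 / u n powr p) * ?S \<le> (\<Sum>\<^sub>\<infinity>\<beta>\<in>D n. ennreal (h \<beta> powr p))"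
      using inv by (simp add: mult.assoc[symmetric] mult.commute)
  qed
  from mult_left_mono[OF this, of "ennreal (u n powr p)"]
  show ?thesis using inv by (simp add: mult.assoc[symmetric])
qed

text \<open>The opposite comparison: put \<open>x\<close> on \<open>\<zeta> n\<close>, multiply
  \<open>f\<close> by \<open>t\<close> on the rest of the subtree, and divide by \<open>u n\<close>;
  by \<open>bal\<close> this is admissible off a null set. Keeping \<open>t\<close> free postpones
  the division by \<open>u n - f (\<zeta> n)\<close> until that difference is known to be
  positive.\<close>

lemma cap_le_competitor:
  assumes u0: "0 < u n" and x: "0 \<le> x" and t: "0 \<le> t" and bal: "u n \<le> x + t * (u n - f (\<zeta> n))"
  shows "ennreal (u n powr p) * cap n
    \<le> ennreal (x powr p) + ennreal (t powr p) * (\<Sum>\<^sub>\<infinity>\<beta>\<in>D n - {\<zeta> n}. ennreal (f \<beta> powr p))"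
proof -
  define h where "h \<beta> = (1 / u n) * (if \<beta> = \<zeta> n then x else t * f \<beta>)" for \<beta>
  let ?R = "\<Sum>\<^sub>\<infinity>\<beta>\<in>D n - {\<zeta> n}. ennreal (f \<beta> powr p)"
  have f0: "0 \<le> f \<beta>" if "\<beta> \<in> D n" for \<beta> using that f_nonneg subtree_edges_subset by blast
  have split: "infsum G A = G (\<zeta> n) + infsum G (A - {\<zeta> n})" if "\<zeta> n \<in> A"
    for G :: "'v set \<Rightarrow> ennreal" and A
    using infsum_insert[of G "A - {\<zeta> n}" "\<zeta> n"] that by (simp add: insert_absorb)
  have "cap n \<le> (\<Sum>\<^sub>\<infinity>\<beta>\<in>D n. ennreal (h \<beta> powr p))"
    unfolding cap_def
  proof (rule relative_capacity_le_off_null[where N = exceptional])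
    show "0 \<le> h \<beta>" if "\<beta> \<in> D n" for \<beta> using that u0 x t f0 by (simp add: h_def)
    let ?N = "E \<inter> boundary_through T (\<zeta> n) \<inter> exceptional"
    have "relative_capacity (edges T) p ?N \<le> 0"
      using relative_capacity_mono[of ?N exceptional "edges T" p] exceptional_null by simp
    then show "relative_capacity (D n) p ?N = 0" by (intro relative_capacity_subtree_null[OF T p \<zeta>]) auto
    fix \<xi> assume "\<xi> \<in> E \<inter> boundary_through T (\<zeta> n) - exceptional"
    then have \<xi>: "\<xi> \<in> E" and \<xi>t: "\<xi> \<in> boundary_through T (\<zeta> n)" and pot: "potential f \<xi> = 1"
      by (auto simp: exceptional_def)
    let ?A = "range \<xi> \<inter> D n"
    have "\<zeta> n \<in> ?A" using boundary_through_nth(2)[OF T \<zeta> \<xi>t] ray_in_subtree by (metis IntI rangeI)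
    note split = split[OF this]
    \<comment> \<open>Off the exceptional set every ray through \<open>\<zeta> n\<close> collects
      the same amount after \<open>\<zeta> n\<close>, namely \<open>u n - f (\<zeta> n)\<close>, so
      one factor \<open>t\<close> works for all of them.\<close>
    define Y where "Y = (\<Sum>\<^sub>\<infinity>\<beta>\<in>?A - {\<zeta> n}. ennreal (f \<beta>))"
    have "1 = (\<Sum>k<n. ennreal (f (\<zeta> k))) + (ennreal (f (\<zeta> n)) + Y)"
      using ray_sum_split[OF T \<zeta> \<xi>t, of "\<lambda>\<beta>. ennreal (f \<beta>)"] pot
      by (simp add: potential_def split Y_def)
    also have "(\<Sum>k<n. ennreal (f (\<zeta> k))) = ennreal (1 - u n)"
      using f_ray_nonneg by (simp add: sum_ennreal u_def)
    finally have 1: "1 = ennreal (1 - u n) + (ennreal (f (\<zeta> n)) + Y)" .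
    then obtain y where y: "Y = ennreal y" "0 \<le> y" by (cases Y) auto
    have "1 - u n \<ge> 0" using f_ray_nonneg by (simp add: u_def sum_nonneg)
    then have "ennreal 1 = ennreal (1 - u n + (f (\<zeta> n) + y))"
      using 1 y f_ray_nonneg by simp
    then have "y = u n - f (\<zeta> n)"
      using \<open>1 - u n \<ge> 0\<close> y f_ray_nonneg[of n] by (subst (asm) ennreal_inj) auto
    then have "1 \<le> (x + t * y) / u n" using bal u0 by simp
    then have "1 \<le> ennreal ((1 / u n) * (x + t * y))" by simp
    also have "\<dots> = ennreal (1 / u n) * (ennreal x + ennreal t * Y)"
    proof -
      have "ennreal x + ennreal t * Y = ennreal (x + t * y)"
        using x t y by (simp add: ennreal_mult')
      moreover have "ennreal ((1 / u n) * (x + t * y)) = ennreal (1 / u n) * ennreal (x + t * y)"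
        using u0 by (intro ennreal_mult') simp
      ultimately show ?thesis by simp
    qed
    also have "ennreal x + ennreal t * Y
        = (\<Sum>\<^sub>\<infinity>\<beta>\<in>?A. ennreal (if \<beta> = \<zeta> n then x else t * f \<beta>))"
    proof -
      have "(\<Sum>\<^sub>\<infinity>\<beta>\<in>?A - {\<zeta> n}. ennreal (if \<beta> = \<zeta> n then x else t * f \<beta>))
          = (\<Sum>\<^sub>\<infinity>\<beta>\<in>?A - {\<zeta> n}. ennreal (t * f \<beta>))" by (intro infsum_cong) auto
      then show ?thesis using t by (simp add: split infsum_ennreal_scale Y_def)
    qed
    finally show "1 \<le> (\<Sum>\<^sub>\<infinity>\<beta>\<in>?A. ennreal (h \<beta>))"
      using u0 unfolding h_def by (subst infsum_ennreal_scale) auto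
  qed
  also have "\<dots> = ennreal ((1 / u n) powr p) *
      (\<Sum>\<^sub>\<infinity>\<beta>\<in>D n. ennreal ((if \<beta> = \<zeta> n then x else t * f \<beta>) powr p))"
    unfolding h_def using u0 x t f0 by (intro infsum_powr_scale) auto
  also have "(\<Sum>\<^sub>\<infinity>\<beta>\<in>D n. ennreal ((if \<beta> = \<zeta> n then x else t * f \<beta>) powr p))
      = ennreal (x powr p) + ennreal (t powr p) * ?R"
  proof -
    have "(\<Sum>\<^sub>\<infinity>\<beta>\<in>D n - {\<zeta> n}. ennreal ((if \<beta> = \<zeta> n then x else t * f \<beta>) powr p))
        = (\<Sum>\<^sub>\<infinity>\<beta>\<in>D n - {\<zeta> n}. ennreal ((t * f \<beta>) powr p))" by (intro infsum_cong) auto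
    also have "\<dots> = ennreal (t powr p) * ?R" using t f0 by (intro infsum_powr_scale) auto
    finally show ?thesis by (simp add: split[OF ray_in_subtree])
  qed
  finally have "ennreal (u n powr p) * cap n \<le> ennreal (u n powr p) *
      (ennreal ((1 / u n) powr p) * (ennreal (x powr p) + ennreal (t powr p) * ?R))"
    by (intro mult_left_mono) auto
  moreover have "ennreal (u n powr p) * ennreal ((1 / u n) powr p) = 1"
    using u0 by (simp add: powr_mult[symmetric] flip: ennreal_mult')
  ultimately show ?thesis by (simp add: mult.assoc[symmetric])
qed

section \<open>The recursion along the geodesic and the series criterion\<close>

lemma u_Suc: "u (Suc n) = u n - f (\<zeta> n)"
  by (simp add: u_def)

text \<open>The two comparisons together fix the energy in the subtree and exhibit
  \<open>f (\<zeta> n)\<close> as a minimiser, so \<open>equilibrium_step_real\<close> applies.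
  Positivity of the next \<open>u\<close> comes with it and drives the induction.\<close>

lemma equilibrium_step:
  assumes u0: "0 < u n"
  shows "0 < u (Suc n)" "f (\<zeta> n) = u n * enn2real (cap n) powr (1 / (p - 1))"
proof -
  define a where "a = f (\<zeta> n)"
  have a0: "0 \<le> a" by (simp add: a_def f_ray_nonneg)
  define R where "R = (\<Sum>\<^sub>\<infinity>\<beta>\<in>D n - {\<zeta> n}. ennreal (f \<beta> powr p))"
  have "R < \<infinity>" unfolding R_def using subtree_edges_subset by (intro energy_finite) blast
  then obtain r where r: "R = ennreal r" "0 \<le> r" by (cases R) auto
  have "cap n < 1" unfolding cap_def by (rule relative_capacity_subtree_less_1[OF T p \<zeta>]) auto
  then obtain c where c: "cap n = ennreal c" "0 \<le> c" "c < 1"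
    by (cases "cap n") (auto simp: ennreal_less_iff simp flip: ennreal_1)
  have S: "(\<Sum>\<^sub>\<infinity>\<beta>\<in>D n. ennreal (f \<beta> powr p)) = ennreal (a powr p) + R"
    using infsum_insert[of "\<lambda>\<beta>. ennreal (f \<beta> powr p)" "D n - {\<zeta> n}" "\<zeta> n"] ray_in_subtree
    by (simp add: insert_absorb a_def R_def)
  have comp: "u n powr p * c \<le> x powr p + t powr p * r"
    if "0 \<le> x" "0 \<le> t" "u n \<le> x + t * (u n - a)" for x t
  proof -
    have "ennreal (u n powr p * c) \<le> ennreal (x powr p + t powr p * r)"
      using cap_le_competitor[OF u0 that[unfolded a_def]] c r
      by (simp add: R_def[symmetric] ennreal_mult' ennreal_plus)
    then show ?thesis using r by (subst (asm) ennreal_le_iff) auto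
  qed
  have "ennreal (a powr p + r) \<le> ennreal (u n powr p * c)"
    using energy_le_cap[OF u0] S r c by (simp add: ennreal_mult' ennreal_plus)
  then have "a powr p + r \<le> u n powr p * c" using c by (subst (asm) ennreal_le_iff) auto
  \<comment> \<open>The choice \<open>x = a\<close>, \<open>t = 1\<close> leaves \<open>f\<close>
    unchanged in the subtree up to the division by \<open>u n\<close>, which gives the missing
    inequality.\<close>
  then have energy: "a powr p + r = u n powr p * c" using comp[of a 1] a0 by simp
  have min: "a powr p + r \<le> x powr p + ((u n - x) / (u n - a)) powr p * r"
    if "a < u n" "0 \<le> x" "x \<le> u n" for x
    using comp[of x "(u n - x) / (u n - a)"] that energy by simp
  note step = equilibrium_step_real[OF p a0 u0 r(2) c(2,3) energy min]
  show "0 < u (Suc n)" using step(1) by (simp add: u_Suc a_def)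
  show "f (\<zeta> n) = u n * enn2real (cap n) powr (1 / (p - 1))"
    using step(2) c by (simp add: a_def)
qed

lemma u_pos: "0 < u n"
proof (induction n)
  case 0
  then show ?case by (simp add: u_def)
next
  case (Suc n)
  then show ?case by (rule equilibrium_step(1))
qed

lemma potential_ne_1_iff:
  "potential f \<zeta> \<noteq> 1 \<longleftrightarrow> (\<Sum>n. ennreal (enn2real (cap n) powr (1 / (p - 1)))) < \<infinity>"
proof -
  let ?d = "\<lambda>n. enn2real (cap n) powr (1 / (p - 1))"
  have d0: "0 \<le> ?d n" for n by simp
  note main = suminf_ne_1_iff_summable_ratio[of "\<lambda>n. f (\<zeta> n)" ?d u,
      OF f_ray_nonneg d0 u_def u_pos equilibrium_step(2)[OF u_pos]]
  have "potential f \<zeta> = (\<Sum>n. ennreal (f (\<zeta> n)))"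
    unfolding potential_def by (rule infsum_range_eq_suminf[OF boundary_inj[OF T \<zeta>]])
  also have "\<dots> = ennreal (suminf (\<lambda>n. f (\<zeta> n)))"
    using main(1) f_ray_nonneg by (intro suminf_ennreal2) auto
  finally have "potential f \<zeta> \<noteq> 1 \<longleftrightarrow> summable ?d"
    using main(2) by simp
  also have "\<dots> \<longleftrightarrow> (\<Sum>n. ennreal (?d n)) < \<infinity>"
  proof
    assume "summable ?d"
    then have "(\<Sum>n. ennreal (?d n)) = ennreal (suminf ?d)" by (intro suminf_ennreal2) auto
    then show "(\<Sum>n. ennreal (?d n)) < \<infinity>" by simp
  next
    assume "(\<Sum>n. ennreal (?d n)) < \<infinity>"
    then show "summable ?d" by (intro summable_suminf_not_top) auto
  qed
  finally show ?thesis .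
qed

end

theorem theorem3p1:
  fixes T :: "'v rtree" and p p' :: real and E :: "(nat \<Rightarrow> 'v set) set"
    and f :: "'v set \<Rightarrow> real" and \<zeta> :: "nat \<Rightarrow> 'v set"
  assumes "rooted_tree T"
    and "1 < p" and "1 / p + 1 / p' = 1"
    and "E \<in> boundary_borel T"
    and "0 < capacity T p E"
    and "equilibrium_function T p E f"
    and "\<zeta> \<in> E"
  shows "potential f \<zeta> \<noteq> 1 \<longleftrightarrow>
    (\<Sum>\<^sub>\<infinity>\<alpha>\<in>range \<zeta>.
       ennreal (enn2real (subtree_capacity T \<alpha> p (E \<inter> boundary_through T \<alpha>)) powr (p' / p))) < \<infinity>"
proof -
  have "root_edge T \<in> edges T" using assms(1) by (simp add: rooted_tree_def)
  then have "{U. openin (boundary_topology T) U} \<subseteq> Pow (boundary T)"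
    using openin_subset[of "boundary_topology T"] by (auto simp: topspace_boundary_topology)
  then have E: "E \<subseteq> boundary T"
    using assms(4) sigma_sets_into_sp unfolding boundary_borel_def by blast
  interpret equilibrium_ray T p E f \<zeta>
    using assms E by unfold_locales auto
  \<comment> \<open>Under the convention \<open>1 / 0 = 0\<close>, the value \<open>p' = 0\<close>
    would force \<open>p = 1\<close>. Conjugacy then turns the exponent \<open>p' / p\<close> into
    \<open>1 / (p - 1)\<close>.\<close>
  have "p' \<noteq> 0" using assms(2,3) by auto
  then have "p + p' = p * p'" using assms(2,3) by (simp add: field_simps)
  then have "p' / p = 1 / (p - 1)" using assms(2) by (simp add: field_simps)
  then show ?thesis
    using potential_ne_1_iff boundary_inj[OF T \<zeta>]
    by (simp add: infsum_range_eq_suminf cap_def subtree_capacity_eq_relative)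
qed

end
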